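(* Let $K$ be a field with non-archimedean absolute value $|\cdot|$ and residue characteristic $p\geq 0$, and let $d\geq 2$ be an integer. Define $$B = B(p,d) := \begin{cases} p^e (d-1) & \text{if } d\geq 3 \text{ and } d=mp^e \text{ for integers } e,m\geq 1 \text{ with } p\nmid m,\\ dp^e & \text{if } d\geq 3 \text{ and } d=1 + mp^e \text{ for integers } e,m\geq 1 \text{ with } p\nmid m,\\ d+1 & \text{otherwise}.\end{cases}$$ Suppose $K$ contains an element $\pi$ such that for every integer $n\geq 2$ with $n\mid B$, $|\pi|^{1/n}\notin |K|$. Then there is a rational function $\phi\in K(z)$ of degree $d$ with potentially good reduction such that for every extension field $L$ of $K$ (inside $\overline{K}$) with $[L:K]<B$, $\phi$ is not conjugate over $L$ to a map of good reduction (i.e. there is no $h\in\mathrm{PGL}(2,L)$ with $h\circ\phi\circ h^{-1}$ of good reduction).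
   Context: $\overline{K}$ is an algebraic closure of $K$, with $|\cdot|$ extended to a non-archimedean absolute value on $\overline{K}$; $|K|=\{|x|:x\in K\}$. For a field $F$ with this absolute value, $\mathcal{O}_F=\{x\in F:|x|\le 1\}$, $\mathcal{M}_F=\{x\in F:|x|<1\}$, residue field $\mathcal{O}_F/\mathcal{M}_F$; $p$ is the characteristic of the residue field of $K$. When $p=0$, the conditions "$d=mp^e$ with $e\ge1$, $p\nmid m$" and "$d=1+mp^e$ with $e\ge1$, $p\nmid m$" never hold. The degree of $\phi=f/g$ (coprime $f,g$) is $\max\{\deg f,\deg g\}$. Good reduction: write $\phi=f/g$ with $f,g\in\mathcal{O}_F[z]$ and some coefficient of $f$ or $g$ of absolute value $1$; $\phi$ has good reduction if $\deg(\overline{f}/\overline{g})=\deg\phi$, where bars denote reduction of coefficients modulo $\mathcal{M}_F$. $\phi\in K(z)$ has potentially good reduction if there are a finite extension $L/K$ in $\overline{K}$ and $h\in\mathrm{PGL}(2,L)$ with $h\circ\phi\circ h^{-1}$ of good reduction. *)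

theory Defs
  imports "HOL-Algebra.Algebraic_Closure_Type" "HOL-Algebra.UnivPoly"
    "HOL-Algebra.Elementary_Groups" "HOL-Computational_Algebra.Computational_Algebra"
begin

hide_const (open) UnivPoly.coeff UnivPoly.monom

text \<open>
  All fields are subfields of one ambient algebraically closed field, given as a type
  \<open>'a\<close>: a field is a set \<open>F :: 'a set\<close> with \<open>subfield F Kbar\<close>.
\<close>

abbreviation Kbar :: "'a::field ring" where
  "Kbar \<equiv> ring_of_type_algebra"

definition nonarch_abs :: "('a::field \<Rightarrow> real) \<Rightarrow> bool" where
  "nonarch_abs v \<longleftrightarrow>
     (\<forall>x. v x \<ge> 0) \<and> (\<forall>x. v x = 0 \<longleftrightarrow> x = 0) \<and>
     (\<forall>x y. v (x * y) = v x * v y) \<and> (\<forall>x y. v (x + y) \<le> max (v x) (v y))"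


subsection \<open>Residue fields\<close>

definition val_ring :: "('a::field \<Rightarrow> real) \<Rightarrow> 'a set \<Rightarrow> 'a ring" where
  "val_ring v F = Kbar\<lparr>carrier := {x \<in> F. v x \<le> 1}\<rparr>"

definition val_ideal :: "('a::field \<Rightarrow> real) \<Rightarrow> 'a set \<Rightarrow> 'a set" where
  "val_ideal v F = {x \<in> F. v x < 1}"

definition residue_field :: "('a::field \<Rightarrow> real) \<Rightarrow> 'a set \<Rightarrow> 'a set ring" where
  "residue_field v F = val_ring v F Quot val_ideal v F"

text \<open>
  \<open>group.ord G x\<close> is the number \<open>n\<close> with \<open>x ^ k = 1 \<longleftrightarrow> n dvd k\<close> for all \<open>k\<close>; it is \<open>0\<close> if
  \<open>x\<close> has infinite order. So the order of \<open>1\<close> in the additive group of a ring is the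
  characteristic.
\<close>

definition residue_char :: "('a::field \<Rightarrow> real) \<Rightarrow> 'a set \<Rightarrow> nat" where
  "residue_char v F =
     group.ord (add_monoid (residue_field v F)) \<one>\<^bsub>residue_field v F\<^esub>"

definition reduce_poly :: "('a::field \<Rightarrow> real) \<Rightarrow> 'a set \<Rightarrow> 'a poly \<Rightarrow> nat \<Rightarrow> 'a set" where
  "reduce_poly v F f = (\<lambda>i. val_ideal v F +>\<^bsub>val_ring v F\<^esub> Polynomial.coeff f i)"

text \<open>
  \<open>quotient_degree k f g n\<close>: over the field \<open>k\<close>, the rational function \<open>f / g\<close> has degree \<open>n\<close>,
  that is, \<open>n\<close> is the larger of the degrees of numerator and denominator after cancelling a
  greatest common divisor. Here \<open>g = 0\<close>, \<open>f \<noteq> 0\<close> is allowed: it is the constant map to infinity.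
\<close>

definition quotient_degree ::
    "('r, 'm) ring_scheme \<Rightarrow> (nat \<Rightarrow> 'r) \<Rightarrow> (nat \<Rightarrow> 'r) \<Rightarrow> nat \<Rightarrow> bool" where
  "quotient_degree k f g n \<longleftrightarrow>
     (\<exists>h \<in> carrier (UP k). \<exists>f' \<in> carrier (UP k). \<exists>g' \<in> carrier (UP k).
        h \<noteq> \<zero>\<^bsub>UP k\<^esub> \<and> f = h \<otimes>\<^bsub>UP k\<^esub> f' \<and> g = h \<otimes>\<^bsub>UP k\<^esub> g' \<and>
        (\<forall>c \<in> carrier (UP k). c divides\<^bsub>UP k\<^esub> f' \<and> c divides\<^bsub>UP k\<^esub> g' \<longrightarrow> c \<in> Units (UP k)) \<and>
        n = max (deg k f') (deg k g'))"


subsection \<open>Rational functions\<close>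

definition poly_over :: "'a::field set \<Rightarrow> 'a poly set" where
  "poly_over S = {f. \<forall>i. Polynomial.coeff f i \<in> S}"

definition ratfun_over :: "'a::field set \<Rightarrow> 'a poly fract set" where
  "ratfun_over F = {Fract f g | f g. f \<in> poly_over F \<and> g \<in> poly_over F \<and> g \<noteq> 0}"

definition ratfun_degree :: "'a::field poly fract \<Rightarrow> nat" where
  "ratfun_degree \<phi> =
     (THE n. \<exists>f g. g \<noteq> 0 \<and> coprime f g \<and> \<phi> = Fract f g \<and>
                   n = max (Polynomial.degree f) (Polynomial.degree g))"

definition poly_at :: "'a::field poly \<Rightarrow> 'a poly fract \<Rightarrow> 'a poly fract" where
  "poly_at f \<psi> = poly (map_poly (\<lambda>c. Fract [:c:] 1) f) \<psi>"

text \<open>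
  Composition is computed from any representation whose denominator does not vanish at \<open>\<psi>\<close>.
  If \<open>\<psi>\<close> is not constant, no denominator vanishes. If \<open>\<psi>\<close> is a constant pole of \<open>\<phi>\<close>, there is
  no such representation and the value is unspecified; conjugating a nonconstant
  function only composes nonconstant functions.
\<close>

definition ratfun_comp :: "'a::field poly fract \<Rightarrow> 'a poly fract \<Rightarrow> 'a poly fract" where
  "ratfun_comp \<phi> \<psi> =
     (THE \<chi>. \<exists>f g. g \<noteq> 0 \<and> \<phi> = Fract f g \<and> poly_at g \<psi> \<noteq> 0 \<and> \<chi> = poly_at f \<psi> / poly_at g \<psi>)"

text \<open>The map \<open>z \<mapsto> (a z + b) / (c z + e)\<close>.\<close>

definition mobius :: "'a::field \<Rightarrow> 'a \<Rightarrow> 'a \<Rightarrow> 'a \<Rightarrow> 'a poly fract" where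
  "mobius a b c e = Fract [:b, a:] [:e, c:]"

text \<open>\<open>\<psi> = h \<circ> \<phi> \<circ> h\<inverse>\<close> for some \<open>h \<in> PGL(2, F)\<close>; \<open>h\<inverse>\<close> is given by the adjugate matrix.\<close>

definition conjugate_over ::
    "'a::field set \<Rightarrow> 'a poly fract \<Rightarrow> 'a poly fract \<Rightarrow> bool" where
  "conjugate_over F \<phi> \<psi> \<longleftrightarrow>
     (\<exists>a \<in> F. \<exists>b \<in> F. \<exists>c \<in> F. \<exists>e \<in> F. a * e - b * c \<noteq> 0 \<and>
        \<psi> = ratfun_comp (ratfun_comp (mobius a b c e) \<phi>) (mobius e (- b) (- c) a))"


subsection \<open>Good reduction\<close>

definition good_reduction ::
    "('a::field \<Rightarrow> real) \<Rightarrow> 'a set \<Rightarrow> 'a poly fract \<Rightarrow> bool" where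
  "good_reduction v F \<phi> \<longleftrightarrow>
     (\<exists>f \<in> poly_over (carrier (val_ring v F)). \<exists>g \<in> poly_over (carrier (val_ring v F)).
        g \<noteq> 0 \<and> \<phi> = Fract f g \<and>
        (\<exists>i. v (Polynomial.coeff f i) = 1 \<or> v (Polynomial.coeff g i) = 1) \<and>
        quotient_degree (residue_field v F) (reduce_poly v F f) (reduce_poly v F g)
          (ratfun_degree \<phi>))"

definition field_extension :: "'a::field set \<Rightarrow> 'a set \<Rightarrow> bool" where
  "field_extension K L \<longleftrightarrow> subfield L Kbar \<and> K \<subseteq> L"

definition potentially_good_reduction ::
    "('a::field \<Rightarrow> real) \<Rightarrow> 'a set \<Rightarrow> 'a poly fract \<Rightarrow> bool" where
  "potentially_good_reduction v K \<phi> \<longleftrightarrow>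
     (\<exists>L \<psi>. field_extension K L \<and> ring.finite_dimension Kbar K L \<and>
        conjugate_over L \<phi> \<psi> \<and> good_reduction v L \<psi>)"


subsection \<open>The bound\<close>

definition bound_B :: "nat \<Rightarrow> nat \<Rightarrow> nat" where
  "bound_B p d =
     (if d \<ge> 3 \<and> (\<exists>e m. e \<ge> 1 \<and> m \<ge> 1 \<and> \<not> p dvd m \<and> d = m * p ^ e) then
        p ^ (THE e. e \<ge> 1 \<and> (\<exists>m\<ge>1. \<not> p dvd m \<and> d = m * p ^ e)) * (d - 1)
      else if d \<ge> 3 \<and> (\<exists>e m. e \<ge> 1 \<and> m \<ge> 1 \<and> \<not> p dvd m \<and> d = 1 + m * p ^ e) then
        d * p ^ (THE e. e \<ge> 1 \<and> (\<exists>m\<ge>1. \<not> p dvd m \<and> d = 1 + m * p ^ e))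
      else d + 1)"


subsection \<open>Well-definedness\<close>

lemma exponent_unique:
  fixes p :: nat
  assumes "m * p ^ e = m' * p ^ e'" "m * p ^ e > 0" "e \<ge> 1" "\<not> p dvd m" "\<not> p dvd m'"
  shows "e = e'"
proof -
  have "p > 0"
    using assms(2,3) by (cases "p = 0") auto
  have aux: "\<not> i < j" if "k * p ^ i = l * p ^ j" "\<not> p dvd k" for k l i j
  proof
    assume "i < j"
    then obtain r where "j = i + Suc r"
      using less_iff_Suc_add by auto
    with that \<open>p > 0\<close> have "k = l * (p * p ^ r)"
      by (simp add: power_add ac_simps)
    with that show False
      by simp
  qed
  show ?thesis
    using aux[of m e m' e'] aux[of m' e' m e] assms by (metis nat_neq_iff)
qed

lemma bound_B_1:
  assumes "d \<ge> 3" "e \<ge> 1" "m \<ge> 1" "\<not> p dvd m" "d = m * p ^ e"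
  shows "bound_B p d = p ^ e * (d - 1)"
proof -
  have "(THE e. e \<ge> 1 \<and> (\<exists>m\<ge>1. \<not> p dvd m \<and> d = m * p ^ e)) = e"
  proof (rule the_equality)
    show "e \<ge> 1 \<and> (\<exists>m\<ge>1. \<not> p dvd m \<and> d = m * p ^ e)"
      using assms by blast
  next
    fix e' assume "e' \<ge> 1 \<and> (\<exists>m\<ge>1. \<not> p dvd m \<and> d = m * p ^ e')"
    then obtain m' where m': "\<not> p dvd m'" "d = m' * p ^ e'"
      by blast
    have "m * p ^ e = m' * p ^ e'" "m * p ^ e > 0"
      using assms(1,5) m'(2) by linarith+
    then have "e = e'"
      using assms(2,4) m'(1) by (rule exponent_unique)
    then show "e' = e" ..
  qed
  moreover have "\<exists>e m. e \<ge> 1 \<and> m \<ge> 1 \<and> \<not> p dvd m \<and> d = m * p ^ e"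
    using assms by blast
  ultimately show ?thesis
    using assms(1) by (simp only: bound_B_def simp_thms if_True)
qed

lemma bound_B_2:
  assumes "d \<ge> 3" "e \<ge> 1" "m \<ge> 1" "\<not> p dvd m" "d = 1 + m * p ^ e"
  shows "bound_B p d = d * p ^ e"
proof -
  have dvd: "p dvd m' * p ^ e'" if "e' \<ge> 1" for m' e'
    using that by (cases e') auto
  have "(THE e. e \<ge> 1 \<and> (\<exists>m\<ge>1. \<not> p dvd m \<and> d = 1 + m * p ^ e)) = e"
  proof (rule the_equality)
    show "e \<ge> 1 \<and> (\<exists>m\<ge>1. \<not> p dvd m \<and> d = 1 + m * p ^ e)"
      using assms by blast
  next
    fix e' assume "e' \<ge> 1 \<and> (\<exists>m\<ge>1. \<not> p dvd m \<and> d = 1 + m * p ^ e')"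
    then obtain m' where m': "\<not> p dvd m'" "d = 1 + m' * p ^ e'"
      by blast
    have "m * p ^ e = m' * p ^ e'" "m * p ^ e > 0"
      using assms(1,5) m'(2) by linarith+
    then have "e = e'"
      using assms(2,4) m'(1) by (rule exponent_unique)
    then show "e' = e" ..
  qed
  moreover have "\<exists>e m. e \<ge> 1 \<and> m \<ge> 1 \<and> \<not> p dvd m \<and> d = 1 + m * p ^ e"
    using assms by blast
  moreover have "\<not> (\<exists>e m. e \<ge> 1 \<and> m \<ge> 1 \<and> \<not> p dvd m \<and> d = m * p ^ e)"
  proof
    assume "\<exists>e m. e \<ge> 1 \<and> m \<ge> 1 \<and> \<not> p dvd m \<and> d = m * p ^ e"
    then have "p dvd d"
      using dvd by blast
    with dvd[OF assms(2), of m] assms(5) have "p dvd 1"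
      by (metis dvd_add_left_iff)
    with assms(4) show False
      by simp
  qed
  ultimately show ?thesis
    using assms(1) by (simp only: bound_B_def simp_thms if_True if_False)
qed

lemma bound_B_char_0: "bound_B 0 d = d + 1"
  unfolding bound_B_def by (auto simp: power_0_left)

lemma poly_bezout:
  fixes f g :: "'a::field poly"
  shows "\<exists>h a b. h = a * f + b * g \<and> h dvd f \<and> h dvd g"
proof (induction "if g = 0 then 0 else Suc (Polynomial.degree g)" arbitrary: f g rule: less_induct)
  case less
  show ?case
  proof (cases "g = 0")
    case True
    then have "f = 1 * f + 0 * g \<and> f dvd f \<and> f dvd g"
      by simp
    then show ?thesis
      by blast
  next
    case False
    have "(if f mod g = 0 then 0 else Suc (Polynomial.degree (f mod g))) <
          (if g = 0 then 0 else Suc (Polynomial.degree g))"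
      using False degree_mod_less'[of g f] by auto
    from less[OF this, of g] obtain h a b
      where h: "h = a * g + b * (f mod g)" "h dvd g" "h dvd f mod g"
      by blast
    have "f mod g = f - f div g * g"
      by (simp add: minus_div_mult_eq_mod)
    then have "h = a * g + b * (f - f div g * g)"
      using h(1) by metis
    then have "h = b * f + (a - b * (f div g)) * g"
      by (simp add: algebra_simps)
    moreover have "h dvd f"
      using h(2,3) by (metis dvd_mod_iff)
    ultimately show ?thesis
      using h(2) by blast
  qed
qed

lemma coprime_poly_dvd_mult:
  fixes f g h :: "'a::field poly"
  assumes "coprime f g" "f dvd g * h"
  shows "f dvd h"
proof -
  obtain u a b where u: "u = a * f + b * g" "u dvd f" "u dvd g"
    using poly_bezout[of f g] by blast
  then have "u dvd 1"
    using assms(1) by (meson coprime_common_divisor)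
  then obtain w where "1 = u * w" ..
  have "h = h * (u * w)"
    using \<open>1 = u * w\<close> by (metis mult_1_right)
  then have "h = f * (a * w * h) + b * w * (g * h)"
    unfolding u(1) by (simp add: algebra_simps)
  moreover have "f dvd f * (a * w * h) + b * w * (g * h)"
    by (rule dvd_add[OF dvd_triv_left dvd_mult[OF assms(2)]])
  ultimately show ?thesis
    by metis
qed

lemma ratfun_degree_Fract:
  fixes f g :: "'a::field poly"
  assumes "g \<noteq> 0" "coprime f g"
  shows "ratfun_degree (Fract f g) = max (Polynomial.degree f) (Polynomial.degree g)"
  unfolding ratfun_degree_def
proof (rule the_equality)
  show "\<exists>f' g'. g' \<noteq> 0 \<and> coprime f' g' \<and> Fract f g = Fract f' g' \<and>
          max (Polynomial.degree f) (Polynomial.degree g) =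
          max (Polynomial.degree f') (Polynomial.degree g')"
    using assms by blast
next
  have deg_eq: "Polynomial.degree p = Polynomial.degree q"
    if "p dvd q" "q dvd p" for p q :: "'a poly"
  proof (cases "p = 0 \<or> q = 0")
    case False
    with that show ?thesis
      by (meson dvd_imp_degree_le le_antisym)
  qed (use that in auto)
  fix n assume "\<exists>f' g'. g' \<noteq> 0 \<and> coprime f' g' \<and> Fract f g = Fract f' g' \<and>
          n = max (Polynomial.degree f') (Polynomial.degree g')"
  then obtain f' g' where *: "g' \<noteq> 0" "coprime f' g'" "Fract f g = Fract f' g'"
      "n = max (Polynomial.degree f') (Polynomial.degree g')"
    by blast
  then have eq: "f * g' = f' * g"
    using assms(1) by (simp add: eq_fract)
  have "f dvd g * f'" "f' dvd g' * f" "g dvd f * g'" "g' dvd f' * g"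
    by (metis eq dvd_triv_left dvd_triv_right mult.commute)+
  then have "f dvd f'" "f' dvd f" "g dvd g'" "g' dvd g"
    using assms(2) *(2) coprime_poly_dvd_mult coprime_commute by blast+
  then show "n = max (Polynomial.degree f) (Polynomial.degree g)"
    using deg_eq *(4) by metis
qed

lemma poly_at_0 [simp]: "poly_at 0 \<psi> = 0"
  by (simp add: poly_at_def)

lemma poly_at_pCons [simp]: "poly_at (pCons a f) \<psi> = Fract [:a:] 1 + \<psi> * poly_at f \<psi>"
  by (cases "a = 0 \<and> f = 0") (auto simp: poly_at_def map_poly_pCons Zero_fract_def)

lemma poly_at_add: "poly_at (f + g) \<psi> = poly_at f \<psi> + poly_at g \<psi>"
proof (induction f g rule: poly_induct2)
  case (pCons a p b q)
  have "Fract [:a + b:] 1 = Fract [:a:] 1 + Fract [:b:] 1"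
    by simp
  with pCons show ?case
    by (simp add: algebra_simps del: add_fract)
qed simp

lemma poly_at_smult: "poly_at (Polynomial.smult c f) \<psi> = Fract [:c:] 1 * poly_at f \<psi>"
proof (induction f)
  case (pCons a p)
  have "Fract [:c * a:] 1 = Fract [:c:] 1 * Fract [:a:] 1"
    by (simp add: mult.commute)
  with pCons show ?case
    by (simp add: algebra_simps del: mult_fract add_fract)
qed simp

lemma poly_at_mult: "poly_at (f * g) \<psi> = poly_at f \<psi> * poly_at g \<psi>"
proof (induction f)
  case (pCons a p)
  have "Fract [:0:] 1 = (0 :: 'a poly fract)"
    by (simp add: Zero_fract_def)
  with pCons show ?case
    by (simp add: poly_at_add poly_at_smult algebra_simps)
qed simp

lemma ratfun_comp_Fract:
  assumes "g \<noteq> 0" "poly_at g \<psi> \<noteq> 0"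
  shows "ratfun_comp (Fract f g) \<psi> = poly_at f \<psi> / poly_at g \<psi>"
  unfolding ratfun_comp_def
proof (rule the_equality)
  show "\<exists>f' g'. g' \<noteq> 0 \<and> Fract f g = Fract f' g' \<and> poly_at g' \<psi> \<noteq> 0 \<and>
          poly_at f \<psi> / poly_at g \<psi> = poly_at f' \<psi> / poly_at g' \<psi>"
    using assms by blast
next
  fix \<chi> assume "\<exists>f' g'. g' \<noteq> 0 \<and> Fract f g = Fract f' g' \<and> poly_at g' \<psi> \<noteq> 0 \<and>
          \<chi> = poly_at f' \<psi> / poly_at g' \<psi>"
  then obtain f' g' where *: "g' \<noteq> 0" "Fract f g = Fract f' g'" "poly_at g' \<psi> \<noteq> 0"
      "\<chi> = poly_at f' \<psi> / poly_at g' \<psi>"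
    by blast
  then have "f * g' = f' * g"
    using assms(1) by (simp add: eq_fract)
  then have "poly_at f \<psi> * poly_at g' \<psi> = poly_at f' \<psi> * poly_at g \<psi>"
    by (metis poly_at_mult)
  then show "\<chi> = poly_at f \<psi> / poly_at g \<psi>"
    using * assms(2) by (simp add: frac_eq_eq)
qed

lemma nonarch_abs_simps:
  assumes "nonarch_abs v"
  shows "v 0 = 0" "v 1 = 1" "v (- x) = v x" "x \<noteq> 0 \<Longrightarrow> v (inverse x) = inverse (v x)"
proof -
  note v = assms[unfolded nonarch_abs_def]
  show "v 0 = 0"
    using v by blast
  have mult: "v (a * b) = v a * v b" and nz: "a \<noteq> 0 \<Longrightarrow> v a \<noteq> 0" and nn: "v a \<ge> 0" for a b
    using v by blast+
  show one: "v 1 = 1"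
    using mult[of 1 1] nz[of 1] by simp
  have "v (- 1) * v (- 1) = 1"
    using mult[of "- 1" "- 1"] one by simp
  then have "v (- 1) = 1"
    using nn[of "- 1"] by (simp add: square_eq_1_iff)
  then show "v (- x) = v x"
    using mult[of "- 1" x] by simp
  show "x \<noteq> 0 \<Longrightarrow> v (inverse x) = inverse (v x)"
    using mult[of x "inverse x"] one nz[of x] by (simp add: field_simps)
qed

lemma residue_field_is_field:
  assumes F: "subfield F Kbar" and v: "nonarch_abs v"
  shows "cring (val_ring v F)" "maximalideal (val_ideal v F) (val_ring v F)"
    "field (residue_field v F)"
proof -
  note v' = v[unfolded nonarch_abs_def]
  have mult: "v (a * b) = v a * v b" and nn: "v a \<ge> 0" and add: "v (a + b) \<le> max (v a) (v b)"
    for a b using v' by blast+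
  note vs = nonarch_abs_simps[OF v]
  interpret R: field "Kbar :: 'a ring"
    by (rule field_from_type_algebra)
  have uminus: "\<ominus>\<^bsub>Kbar\<^esub> x = - x" for x :: 'a
    by (intro R.minus_equality) (auto simp: ring_of_type_algebra_def)
  have inverse: "inv\<^bsub>Kbar\<^esub> x = inverse x" if "x \<noteq> 0" for x :: 'a
    using that by (intro R.inv_char) (auto simp: ring_of_type_algebra_def)
  note Fsub = subfieldE(1)[OF F]
  have cl: "0 \<in> F" "1 \<in> F" "\<And>x. x \<in> F \<Longrightarrow> - x \<in> F"
      "\<And>x y. x \<in> F \<Longrightarrow> y \<in> F \<Longrightarrow> x * y \<in> F" "\<And>x y. x \<in> F \<Longrightarrow> y \<in> F \<Longrightarrow> x + y \<in> F"
    using subringE[OF Fsub] uminus by (auto simp: ring_of_type_algebra_def)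
  have icl: "inverse x \<in> F" if "x \<in> F" "x \<noteq> 0" for x
    using R.subfield_m_inv(1)[OF F, of x] that inverse[of x]
    by (auto simp: ring_of_type_algebra_def)
  have sub: "subring {x \<in> F. v x \<le> 1} (Kbar :: 'a ring)"
  proof (rule R.subringI)
    fix x y assume xy: "x \<in> {x \<in> F. v x \<le> 1}" "y \<in> {x \<in> F. v x \<le> 1}"
    show "x \<otimes>\<^bsub>Kbar\<^esub> y \<in> {x \<in> F. v x \<le> 1}"
      using xy cl nn by (auto simp: ring_of_type_algebra_def mult mult_le_one)
    show "x \<oplus>\<^bsub>Kbar\<^esub> y \<in> {x \<in> F. v x \<le> 1}"
      using xy cl add[of x y] by (auto simp: ring_of_type_algebra_def)
  next
    fix x assume "x \<in> {x \<in> F. v x \<le> 1}"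
    then show "\<ominus>\<^bsub>Kbar\<^esub> x \<in> {x \<in> F. v x \<le> 1}"
      using cl vs unfolding uminus by simp
  qed (use cl vs in \<open>auto simp: ring_of_type_algebra_def\<close>)
  show cr: "cring (val_ring v F)"
    unfolding val_ring_def using R.subring_is_domain[OF sub] by (simp add: domain_def)
  interpret O: cring "val_ring v F"
    by (rule cr)
  have ops: "carrier (val_ring v F) = {x \<in> F. v x \<le> 1}" "\<one>\<^bsub>val_ring v F\<^esub> = 1" "\<zero>\<^bsub>val_ring v F\<^esub> = 0"
      "x \<otimes>\<^bsub>val_ring v F\<^esub> y = x * y" "x \<oplus>\<^bsub>val_ring v F\<^esub> y = x + y" for x y
    by (auto simp: val_ring_def ring_of_type_algebra_def)
  have ominus: "\<ominus>\<^bsub>val_ring v F\<^esub> x = - x" if "x \<in> F" "v x \<le> 1" for x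
    using that cl vs by (intro O.minus_equality) (auto simp: ops)
  have "ideal (val_ideal v F) (val_ring v F)"
  proof (rule idealI[OF O.ring_axioms])
    show "subgroup (val_ideal v F) (add_monoid (val_ring v F))"
    proof (rule O.add.subgroupI)
      show "val_ideal v F \<subseteq> carrier (val_ring v F)"
        by (auto simp: val_ideal_def ops)
      show "val_ideal v F \<noteq> {}"
        using cl vs by (auto simp: val_ideal_def)
    next
      fix x assume "x \<in> val_ideal v F"
      then show "\<ominus>\<^bsub>val_ring v F\<^esub> x \<in> val_ideal v F"
        using cl vs by (auto simp: val_ideal_def ominus)
    next
      fix x y assume "x \<in> val_ideal v F" "y \<in> val_ideal v F"
      then show "x \<oplus>\<^bsub>val_ring v F\<^esub> y \<in> val_ideal v F"
        using cl add[of x y] by (auto simp: val_ideal_def ops)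
    qed
  next
    fix a x assume ax: "a \<in> val_ideal v F" "x \<in> carrier (val_ring v F)"
    then have "v a * v x < 1"
      using nn[of a] nn[of x] mult_left_le[of "v x" "v a"] by (auto simp: val_ideal_def ops)
    then show "x \<otimes>\<^bsub>val_ring v F\<^esub> a \<in> val_ideal v F" "a \<otimes>\<^bsub>val_ring v F\<^esub> x \<in> val_ideal v F"
      using ax cl by (auto simp: val_ideal_def ops mult mult.commute)
  qed
  then show mx: "maximalideal (val_ideal v F) (val_ring v F)"
  proof (rule maximalidealI)
    have "1 \<in> carrier (val_ring v F)" "1 \<notin> val_ideal v F"
      using cl vs by (auto simp: ops val_ideal_def)
    then show "carrier (val_ring v F) \<noteq> val_ideal v F"
      by blast
  next
    fix J assume J: "ideal J (val_ring v F)" "val_ideal v F \<subseteq> J" "J \<subseteq> carrier (val_ring v F)"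
    show "J = val_ideal v F \<or> J = carrier (val_ring v F)"
    proof (cases "J \<subseteq> val_ideal v F")
      case False
      then obtain x where x: "x \<in> J" "x \<in> F" "v x = 1"
        using J(3) by (force simp: ops val_ideal_def)
      then have "x \<noteq> 0"
        using vs(1) by auto
      with x have "inverse x \<in> carrier (val_ring v F)"
        using vs(4)[of x] icl[of x] by (simp add: ops)
      then have "1 \<in> J"
        using ideal.I_l_closed[OF J(1) x(1), of "inverse x"] \<open>x \<noteq> 0\<close> by (simp add: ops)
      then show ?thesis
        using ideal.one_imp_carrier[OF J(1)] by (simp add: ops)
    qed (use J(2) in auto)
  qed
  show "field (residue_field v F)"
    unfolding residue_field_def using maximalideal.quotient_is_field[OF mx cr] .
qed

end

theory Submission
  imports Defs
begin

text \<open>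
  If \<open>\<phi>\<close> lifts to a homogeneous map \<open>T\<close> of degree \<open>d\<close> and \<open>H \<circ> \<phi> \<circ> H\<inverse>\<close> has good reduction, then the
  norm \<open>N X = \<parallel>H X\<parallel>\<close> satisfies \<open>N (T X) = \<kappa> * N X ^ d\<close>. For two such norms the ratio is bounded, and iterating
  \<open>T\<close> shows that it is constant. So, if \<open>\<phi>\<close> has good reduction in the coordinate \<open>w\<close> with \<open>z = a + c w\<close>,
  any field over which \<open>\<phi>\<close> is conjugate to a map of good reduction contains a point of the
  disk \<open>v (z - a) \<le> v c\<close> and an element of absolute value \<open>v c\<close>.

  The examples are \<open>z + A (z ^ q - a ^ q) ^ m\<close> if \<open>d = m q\<close>, \<open>z + A / (z ^ q - a ^ q) ^ m\<close> if \<open>d = 1 + m q\<close>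
  (with \<open>q = p ^ e\<close>), and \<open>x / z ^ d\<close> otherwise, where \<open>v a\<close> and \<open>v c\<close> are chosen so that the field
  contains an element \<open>y\<close> such that \<open>v y\<close> has order \<open>B\<close> modulo the value group of \<open>K\<close>. Then the powers
  \<open>y ^ i\<close>, \<open>i < B\<close>, are linearly independent over \<open>K\<close>.
\<close>

subsection \<open>Polynomials over a non-archimedean field\<close>

text \<open>Let \<open>W\<close> be \<open>z ^ q - a ^ q\<close> divided by \<open>c ^ q\<close>. In
  the coordinate \<open>z = a + c w\<close> the wild examples become \<open>w + W ^ m\<close> and
  \<open>w + 1 / W ^ m\<close>, provided that \<open>A\<close> is \<open>1 / c ^ (d - 1)\<close>,
  respectively \<open>c ^ d\<close>. To be defined over \<open>K\<close> they need only
  \<open>a ^ q\<close> and \<open>c ^ D\<close> in \<open>K\<close>, where \<open>D\<close> is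
  \<open>d - 1\<close>, respectively \<open>d\<close>. Put \<open>a ^ q = x ^ i\<close> and
  \<open>c ^ D = x ^ j\<close>; then \<open>v (c / a)\<close> is \<open>v x\<close> to the power
  \<open>j/D - i/q\<close>. As \<open>q\<close> is coprime to \<open>D\<close>, Bezout makes this
  exponent \<open>1/(q D)\<close>, which is the origin of \<open>B = q D\<close>. A field
  \<open>L\<close> with a good coordinate contains some centre \<open>t\<close> of the disk rather
  than \<open>a\<close>, but \<open>v c < v a\<close> forces \<open>v t = v a\<close>, so the ratio
  of radius and centre is still seen in \<open>L\<close>. The obstacle is the integrality of
  \<open>W\<close>: \<open>v p * v (a / c) ^ q\<close> must be at most 1. Since
  \<open>v (c / a) ^ q\<close> is \<open>v x\<close> to the power \<open>1/D\<close>, it suffices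
  that \<open>v p <= v x < 1\<close>. The given \<pi> can be far from this range, so in the wild
  cases it is traded for another element \<open>x\<close> of \<open>K\<close>.\<close>

text \<open>Stated with degree bounds instead of degrees, so that homogenization stays
  multiplicative at the point at infinity even if a factor drops degree.\<close>

lemma coeff_mult_bounded:
  fixes f g :: "'a::comm_semiring_0 poly"
  assumes "degree f \<le> m" "degree g \<le> n"
  shows "coeff (f * g) (m + n) = coeff f m * coeff g n"
proof -
  have "coeff (f * g) (m + n) = (\<Sum>i\<le>m + n. coeff f i * coeff g (m + n - i))"
    by (simp add: coeff_mult)
  also have "\<dots> = (\<Sum>i\<in>{m}. coeff f i * coeff g (m + n - i))"
  proof (intro sum.mono_neutral_right ballI)
    fix i assume "i \<in> {..m + n} - {m}"
    then consider "i < m" | "m < i"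
      by force
    then show "coeff f i * coeff g (m + n - i) = 0"
      using assms by cases (auto simp: coeff_eq_0)
  qed auto
  finally show ?thesis by simp
qed

locale nonarch_field =
  fixes v :: "'a::field \<Rightarrow> real"
  assumes nonarch: "nonarch_abs v"
begin

lemma v_nonneg [simp]: "v x \<ge> 0"
  and v_eq_0 [simp]: "v x = 0 \<longleftrightarrow> x = 0"
  and v_mult: "v (x * y) = v x * v y"
  and v_add: "v (x + y) \<le> max (v x) (v y)"
  using nonarch unfolding nonarch_abs_def by blast+

lemmas v_0 [simp] = nonarch_abs_simps(1)[OF nonarch]
  and v_1 [simp] = nonarch_abs_simps(2)[OF nonarch]
  and v_minus [simp] = nonarch_abs_simps(3)[OF nonarch]

lemma v_pos [simp]: "v x > 0 \<longleftrightarrow> x \<noteq> 0"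
  using v_nonneg[of x] v_eq_0[of x] by linarith

lemma v_inverse: "v (inverse x) = inverse (v x)"
  using nonarch_abs_simps(4)[OF nonarch, of x] by (cases "x = 0") auto

lemma v_divide: "v (x / y) = v x / v y"
  by (simp add: divide_inverse v_mult v_inverse)

lemma v_power: "v (x ^ n) = v x ^ n"
  by (induction n) (auto simp: v_mult)

lemma v_diff: "v (x - y) \<le> max (v x) (v y)"
  using v_add[of x "- y"] by simp

lemma v_add_eq:
  assumes "v x < v y"
  shows "v (x + y) = v y"
proof (rule antisym)
  show "v (x + y) \<le> v y"
    using v_add[of x y] assms by simp
  have "v y \<le> max (v (x + y)) (v x)"
    using v_diff[of "x + y" x] by simp
  then show "v y \<le> v (x + y)"
    using assms by linarith
qed

lemma v_sum_le:
  assumes "0 \<le> c" "\<And>i. i \<in> A \<Longrightarrow> v (f i) \<le> c"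
  shows "v (sum f A) \<le> c"
  using assms(2)
proof (induction A rule: infinite_finite_induct)
  case (insert i A)
  then show ?case
    using v_add[of "f i" "sum f A"] by (simp add: order_trans)
qed (use assms(1) in auto)

lemma v_sum_less:
  assumes "0 < c" "\<And>i. i \<in> A \<Longrightarrow> v (f i) < c"
  shows "v (sum f A) < c"
  using assms(2)
proof (induction A rule: infinite_finite_induct)
  case (insert i A)
  then show ?case
    using v_add[of "f i" "sum f A"] by (simp add: le_less_trans)
qed (use assms(1) in auto)

lemma v_of_nat_le: "v (of_nat n) \<le> 1"
proof (induction n)
  case (Suc n)
  then show ?case
    using v_add[of 1 "of_nat n"] by simp
qed simp

definition integral_poly :: "'a poly \<Rightarrow> bool" where
  "integral_poly f \<longleftrightarrow> (\<forall>i. v (coeff f i) \<le> 1)"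

definition small_poly :: "'a poly \<Rightarrow> bool" where
  "small_poly f \<longleftrightarrow> (\<forall>i. v (coeff f i) < 1)"

lemma integral_poly_0 [simp]: "integral_poly 0"
  and small_poly_0 [simp]: "small_poly 0"
  and integral_poly_1 [simp]: "integral_poly 1"
  by (auto simp: integral_poly_def small_poly_def coeff_1)

lemma integral_poly_pCons [simp]: "integral_poly (pCons c f) \<longleftrightarrow> v c \<le> 1 \<and> integral_poly f"
  unfolding integral_poly_def by (auto simp: coeff_pCons split: nat.splits)

lemma integral_poly_add: "integral_poly f \<Longrightarrow> integral_poly g \<Longrightarrow> integral_poly (f + g)"
  unfolding integral_poly_def coeff_add by (meson max.boundedI order_trans v_add)

lemma integral_poly_diff: "integral_poly f \<Longrightarrow> integral_poly g \<Longrightarrow> integral_poly (f - g)"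
  unfolding integral_poly_def coeff_diff by (meson max.boundedI order_trans v_diff)

lemma integral_poly_mult: "integral_poly f \<Longrightarrow> integral_poly g \<Longrightarrow> integral_poly (f * g)"
  unfolding integral_poly_def coeff_mult
  by (auto intro!: v_sum_le mult_le_one simp: v_mult)

lemma integral_poly_power: "integral_poly f \<Longrightarrow> integral_poly (f ^ n)"
  by (induction n) (auto intro: integral_poly_mult)

lemma small_poly_add: "small_poly f \<Longrightarrow> small_poly g \<Longrightarrow> small_poly (f + g)"
  unfolding small_poly_def coeff_add by (meson max_less_iff_conj le_less_trans v_add)

lemma small_poly_diff: "small_poly f \<Longrightarrow> small_poly g \<Longrightarrow> small_poly (f - g)"
  unfolding small_poly_def coeff_diff by (meson max_less_iff_conj le_less_trans v_diff)

lemma small_poly_diff_commute: "small_poly (f - g) \<longleftrightarrow> small_poly (g - f)"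
  unfolding small_poly_def coeff_diff by (metis minus_diff_eq v_minus)

lemma small_poly_mult:
  assumes "integral_poly f" "small_poly g"
  shows "small_poly (f * g)"
  unfolding small_poly_def coeff_mult
proof (intro allI v_sum_less)
  fix n i
  have "v (coeff f i) * v (coeff g (n - i)) \<le> v (coeff g (n - i))"
    using assms(1) by (auto intro!: mult_left_le_one_le simp: integral_poly_def)
  also have "\<dots> < 1"
    using assms(2) by (simp add: small_poly_def)
  finally show "v (coeff f i * coeff g (n - i)) < 1"
    by (simp add: v_mult)
qed simp

text \<open>Gauss's lemma: polynomials over the residue field have no zero divisors. With
  \<open>i\<close> and \<open>j\<close> the lowest indices of unit coefficients, every other term of
  the coefficient at \<open>i + j\<close> contains a coefficient below \<open>i\<close> or below
  \<open>j\<close>, hence is small.\<close>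

lemma small_poly_multD:
  assumes "integral_poly f" "integral_poly g" "small_poly (f * g)"
  shows "small_poly f \<or> small_poly g"
proof (rule ccontr)
  assume "\<not> (small_poly f \<or> small_poly g)"
  then have ex: "\<exists>i. \<not> v (coeff f i) < 1" "\<exists>j. \<not> v (coeff g j) < 1"
    by (auto simp: small_poly_def)
  define i where "i = (LEAST i. \<not> v (coeff f i) < 1)"
  define j where "j = (LEAST j. \<not> v (coeff g j) < 1)"
  have i: "\<not> v (coeff f i) < 1" "\<And>k. k < i \<Longrightarrow> v (coeff f k) < 1"
    and j: "\<not> v (coeff g j) < 1" "\<And>k. k < j \<Longrightarrow> v (coeff g k) < 1"
    using LeastI_ex[OF ex(1)] not_less_Least[of _ "\<lambda>i. \<not> v (coeff f i) < 1"]
      LeastI_ex[OF ex(2)] not_less_Least[of _ "\<lambda>i. \<not> v (coeff g i) < 1"]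
    unfolding i_def j_def by blast+
  have le: "v (coeff f k) \<le> 1" "v (coeff g k) \<le> 1" for k
    using assms by (auto simp: integral_poly_def)
  have "coeff (f * g) (i + j) =
      (\<Sum>k\<in>{..i + j} - {i}. coeff f k * coeff g (i + j - k)) + coeff f i * coeff g j"
    by (simp add: coeff_mult sum.remove[of "{..i + j}" i])
  moreover have "v (\<Sum>k\<in>{..i + j} - {i}. coeff f k * coeff g (i + j - k)) < 1"
  proof (rule v_sum_less)
    fix k assume "k \<in> {..i + j} - {i}"
    then consider "k < i" | "i + j - k < j"
      by force
    then show "v (coeff f k * coeff g (i + j - k)) < 1"
    proof cases
      case 1
      then show ?thesis
        using i(2) le(2)[of "i + j - k"] mult_left_le[of "v (coeff g (i + j - k))" "v (coeff f k)"]
        by (force simp: v_mult)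
    next
      case 2
      then show ?thesis
        using j(2) le(1)[of k] mult_left_le_one_le[of "v (coeff g (i + j - k))" "v (coeff f k)"]
        by (force simp: v_mult)
    qed
  qed simp
  moreover have "v (coeff f i * coeff g j) = 1"
    using i(1) j(1) le(1)[of i] le(2)[of j] by (simp add: v_mult)
  ultimately have "v (coeff (f * g) (i + j)) = 1"
    using v_add_eq by metis
  then show False
    using assms(3) by (metis less_irrefl small_poly_def)
qed

lemma integral_poly_eval:
  assumes "integral_poly f" "v x \<le> 1"
  shows "v (poly f x) \<le> 1"
  unfolding poly_altdef using assms
  by (auto intro!: v_sum_le mult_le_one power_le_one simp: v_mult v_power integral_poly_def)

lemma small_poly_eval:
  assumes "small_poly f" "v x \<le> 1"
  shows "v (poly f x) < 1"
  unfolding poly_altdef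
proof (rule v_sum_less)
  fix i
  have "v (coeff f i) * v x ^ i \<le> v (coeff f i)"
    using assms(2) by (intro mult_left_le power_le_one) auto
  also have "\<dots> < 1"
    using assms(1) by (simp add: small_poly_def)
  finally show "v (coeff f i * x ^ i) < 1"
    by (simp add: v_mult v_power)
qed simp

lemma poly_sum_upto:
  fixes f :: "'b::comm_semiring_1 poly"
  assumes "degree f \<le> d"
  shows "poly f x = (\<Sum>i\<le>d. coeff f i * x ^ i)"
  unfolding poly_altdef using assms
  by (intro sum.mono_neutral_left) (auto simp: coeff_eq_0)

lemma integral_poly_eval_le:
  assumes "integral_poly f" "degree f \<le> d" "v x \<ge> 1"
  shows "v (poly f x) \<le> v x ^ d"
  unfolding poly_sum_upto[OF assms(2)]
proof (rule v_sum_le)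
  fix i assume "i \<in> {..d}"
  then have "v (coeff f i) * v x ^ i \<le> 1 * v x ^ d"
    using assms by (intro mult_mono power_increasing) (auto simp: integral_poly_def)
  then show "v (coeff f i * x ^ i) \<le> v x ^ d"
    by (simp add: v_mult v_power)
qed simp

lemma integral_poly_eval_eq:
  assumes "integral_poly f" "degree f \<le> d" "v (coeff f d) = 1" "v x > 1"
  shows "v (poly f x) = v x ^ d"
proof -
  have "v (\<Sum>i<d. coeff f i * x ^ i) < v x ^ d"
  proof (rule v_sum_less)
    fix i assume "i \<in> {..<d}"
    then have "v x ^ i < v x ^ d"
      using assms(4) by (intro power_strict_increasing) auto
    moreover have "v (coeff f i) * v x ^ i \<le> 1 * v x ^ i"
      using assms by (intro mult_right_mono) (auto simp: integral_poly_def)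
    ultimately show "v (coeff f i * x ^ i) < v x ^ d"
      by (simp add: v_mult v_power)
  qed (rule zero_less_power, use assms(4) in linarith)
  moreover have "v (coeff f d * x ^ d) = v x ^ d"
    using assms(3) by (simp add: v_mult v_power)
  ultimately show ?thesis
    unfolding poly_sum_upto[OF assms(2)] lessThan_Suc_atMost[symmetric]
    by (simp add: v_add_eq)
qed

end

text \<open>The value at \<open>(x, y)\<close> of the homogenization of \<open>f\<close> in degree \<open>d\<close>, for \<open>degree f \<le> d\<close>.\<close>

definition hom_eval :: "nat \<Rightarrow> 'a::field poly \<Rightarrow> 'a \<Rightarrow> 'a \<Rightarrow> 'a" where
  "hom_eval d f x y = (if y = 0 then coeff f d * x ^ d else y ^ d * poly f (x / y))"

lemma hom_eval_0 [simp]: "hom_eval d 0 x y = 0"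
  by (simp add: hom_eval_def)

lemma hom_eval_add: "hom_eval d (f + g) x y = hom_eval d f x y + hom_eval d g x y"
  by (simp add: hom_eval_def algebra_simps)

lemma hom_eval_smult: "hom_eval d (smult c f) x y = c * hom_eval d f x y"
  by (simp add: hom_eval_def algebra_simps)

lemma hom_eval_sum: "hom_eval d (\<Sum>i\<in>A. f i) x y = (\<Sum>i\<in>A. hom_eval d (f i) x y)"
  by (induction A rule: infinite_finite_induct) (auto simp: hom_eval_add)

lemma hom_eval_mult:
  assumes "degree f \<le> m" "degree g \<le> n"
  shows "hom_eval (m + n) (f * g) x y = hom_eval m f x y * hom_eval n g x y"
  using coeff_mult_bounded[OF assms] by (simp add: hom_eval_def power_add)

lemma hom_eval_1 [simp]: "hom_eval 0 1 x y = 1"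
  by (simp add: hom_eval_def)

lemma degree_power_le_exponent:
  "degree f \<le> 1 \<Longrightarrow> degree (f ^ n) \<le> n"
  by (metis degree_power_le mult_le_mono1 nat_mult_1 order_trans)

lemma hom_eval_power:
  assumes "degree f \<le> 1"
  shows "hom_eval n (f ^ n) x y = hom_eval 1 f x y ^ n"
proof (induction n)
  case (Suc n)
  with hom_eval_mult[OF assms degree_power_le_exponent[OF assms]] show ?case
    by simp
qed simp

lemma hom_eval_linear: "hom_eval 1 [:b, a:] x y = a * x + b * y"
  by (auto simp: hom_eval_def field_simps)

lemma hom_eval_sum_upto:
  assumes "degree f \<le> d"
  shows "hom_eval d f x y = (\<Sum>i\<le>d. coeff f i * x ^ i * y ^ (d - i))"
proof (cases "y = 0")
  case True
  have "(\<Sum>i\<le>d. coeff f i * x ^ i * y ^ (d - i)) = (\<Sum>i\<in>{d}. coeff f i * x ^ i * y ^ (d - i))"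
    using True by (intro sum.mono_neutral_right) auto
  with True show ?thesis
    by (simp add: hom_eval_def)
next
  case False
  have "poly f (x / y) = (\<Sum>i\<le>d. coeff f i * (x / y) ^ i)"
    unfolding poly_altdef using assms by (intro sum.mono_neutral_left) (auto simp: coeff_eq_0)
  then have "y ^ d * poly f (x / y) = (\<Sum>i\<le>d. coeff f i * x ^ i * y ^ (d - i))"
    using False by (auto simp: sum_distrib_left power_divide power_diff field_simps intro!: sum.cong)
  with False show ?thesis
    by (simp add: hom_eval_def)
qed

lemma hom_eval_scale:
  assumes "degree f \<le> d"
  shows "hom_eval d f (c * x) (c * y) = c ^ d * hom_eval d f x y"
proof -
  have "c ^ i * c ^ (d - i) = c ^ d" if "i \<le> d" for i
    using that by (simp flip: power_add)
  then show ?thesis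
    unfolding hom_eval_sum_upto[OF assms] sum_distrib_left
    by (intro sum.cong) (auto simp: power_mult_distrib algebra_simps)
qed

section \<open>Maps of good reduction and the maximum norm\<close>

context nonarch_field
begin

text \<open>
  A polynomial map of degree \<open>d\<close> with integral coefficients whose reduction still has
  degree \<open>d\<close> and no common zero.
\<close>

definition good_pair :: "nat \<Rightarrow> 'a poly \<Rightarrow> 'a poly \<Rightarrow> bool" where
  "good_pair d f g \<longleftrightarrow> integral_poly f \<and> integral_poly g \<and> degree f \<le> d \<and> degree g \<le> d \<and>
     (v (coeff f d) = 1 \<or> v (coeff g d) = 1) \<and>
     (\<exists>a b. integral_poly a \<and> integral_poly b \<and> small_poly (a * f + b * g - 1))"

text \<open>On the unit disk the Bezout identity modulo small polynomials prevents both values from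
  being small; outside it the unit coefficient in degree \<open>d\<close> dominates.\<close>

lemma good_pair_eval:
  assumes "good_pair d f g"
  shows "max (v (poly f x)) (v (poly g x)) = max (v x) 1 ^ d"
proof -
  obtain a b where fg: "integral_poly f" "integral_poly g" "degree f \<le> d" "degree g \<le> d"
      "v (coeff f d) = 1 \<or> v (coeff g d) = 1"
    and ab: "integral_poly a" "integral_poly b" "small_poly (a * f + b * g - 1)"
    using assms by (auto simp: good_pair_def)
  show ?thesis
  proof (cases "v x \<le> 1")
    case True
    have le: "v (poly f x) \<le> 1" "v (poly g x) \<le> 1" "v (poly a x) \<le> 1" "v (poly b x) \<le> 1"
      using integral_poly_eval True fg ab by blast+
    moreover have "\<not> max (v (poly f x)) (v (poly g x)) < 1"
    proof
      assume "max (v (poly f x)) (v (poly g x)) < 1"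
      then have "v (poly a x * poly f x) < 1" "v (poly b x * poly g x) < 1"
        using le mult_left_le_one_le[of "v (poly f x)" "v (poly a x)"]
          mult_left_le_one_le[of "v (poly g x)" "v (poly b x)"] by (auto simp: v_mult)
      then have "v (poly a x * poly f x + poly b x * poly g x) < 1"
        using v_add[of "poly a x * poly f x" "poly b x * poly g x"] by simp
      moreover have "v (poly a x * poly f x + poly b x * poly g x - 1) < 1"
        using small_poly_eval[OF ab(3) True] by simp
      ultimately have "v 1 < 1"
        using v_diff[of "poly a x * poly f x + poly b x * poly g x"
            "poly a x * poly f x + poly b x * poly g x - 1"] by simp
      then show False by simp
    qed
    ultimately show ?thesis
      using True by (simp add: max_def split: if_splits)
  next
    case False
    then have "v (poly f x) \<le> v x ^ d" "v (poly g x) \<le> v x ^ d"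
        "v (poly f x) = v x ^ d \<or> v (poly g x) = v x ^ d"
      using integral_poly_eval_le integral_poly_eval_eq fg by force+
    with False show ?thesis
      by (auto simp: max_def)
  qed
qed

text \<open>The norm equation of a map that has good reduction in the given coordinate: the norm is
  the maximum norm and the constant is 1.\<close>

lemma good_pair_hom_eval:
  assumes "good_pair d f g"
  shows "max (v (hom_eval d f x y)) (v (hom_eval d g x y)) = max (v x) (v y) ^ d"
proof (cases "y = 0")
  case True
  have "v (coeff f d) \<le> 1" "v (coeff g d) \<le> 1" "v (coeff f d) = 1 \<or> v (coeff g d) = 1"
    using assms by (auto simp: good_pair_def integral_poly_def)
  then have "max (v (coeff f d)) (v (coeff g d)) = 1"
    by auto
  moreover have "max (v (coeff f d) * v x ^ d) (v (coeff g d) * v x ^ d) =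
      max (v (coeff f d)) (v (coeff g d)) * v x ^ d"
    by (simp add: max_mult_distrib_right)
  ultimately show ?thesis
    using True by (simp add: hom_eval_def v_mult v_power max_absorb1)
next
  case False
  have "max (v (hom_eval d f x y)) (v (hom_eval d g x y)) =
      v y ^ d * max (v (poly f (x / y))) (v (poly g (x / y)))"
    using False by (simp add: hom_eval_def v_mult v_power max_mult_distrib_left)
  also have "\<dots> = (v y * max (v (x / y)) 1) ^ d"
    by (simp add: good_pair_eval[OF assms] power_mult_distrib)
  also have "v y * max (v (x / y)) 1 = max (v x) (v y)"
    using False by (simp add: v_divide max_mult_distrib_left)
  finally show ?thesis .
qed

end

subsection \<open>Reduction of polynomials\<close>

text \<open>The gcd-based coprimality in \<open>quotient_degree\<close> yields a Bezout identity, as \<open>UP R\<close> is Euclidean.\<close>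

lemma (in field) UP_bezout:
  assumes f: "f \<in> carrier (UP R)" and g: "g \<in> carrier (UP R)"
    and cop: "\<And>c. c \<in> carrier (UP R) \<Longrightarrow> c divides\<^bsub>UP R\<^esub> f \<Longrightarrow> c divides\<^bsub>UP R\<^esub> g \<Longrightarrow> c \<in> Units (UP R)"
  shows "\<exists>a \<in> carrier (UP R). \<exists>b \<in> carrier (UP R).
           a \<otimes>\<^bsub>UP R\<^esub> f \<oplus>\<^bsub>UP R\<^esub> b \<otimes>\<^bsub>UP R\<^esub> g = \<one>\<^bsub>UP R\<^esub>"
proof -
  have units_pow: "l [^] (n::nat) \<in> Units R" if "l \<in> carrier R" "l \<noteq> \<zero>" for l n
    using that Units_pow_closed[of l n] field_Units by simp
  interpret UP_domain R "UP R"
    by unfold_locales auto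
  interpret E: euclidean_domain "UP R" "deg R"
  proof (rule domain.euclidean_domainI[OF UP_domain])
    fix a b assume "a \<in> carrier (UP R) - {\<zero>\<^bsub>UP R\<^esub>}" "b \<in> carrier (UP R) - {\<zero>\<^bsub>UP R\<^esub>}"
    then have a: "a \<in> carrier (UP R)" and b: "b \<in> carrier (UP R)" "b \<noteq> \<zero>\<^bsub>UP R\<^esub>"
      by auto
    define l where "l = UnivPoly.coeff (UP R) b (deg R b)"
    obtain q r n where qr: "q \<in> carrier (UP R)" "r \<in> carrier (UP R)"
        "l [^] (n::nat) \<odot>\<^bsub>UP R\<^esub> a = b \<otimes>\<^bsub>UP R\<^esub> q \<oplus>\<^bsub>UP R\<^esub> r"
        "r = \<zero>\<^bsub>UP R\<^esub> \<or> deg R r < deg R b"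
      using long_div_theorem[OF b(1) a b(2)] unfolding l_def by blast
    have l: "l \<in> carrier R" "l \<noteq> \<zero>"
      using lcoeff_nonzero2[OF b] b(1) unfolding l_def by auto
    then have ln: "l [^] n \<in> Units R"
      by (rule units_pow)
    \<comment> \<open>\<open>long_div_theorem\<close> is pseudo-division: it divides
      \<open>a\<close> multiplied by a power of the leading coefficient. Over a field this power can
      be inverted.\<close>
    define i where "i = inv (l [^] n)"
    have i: "i \<in> carrier R" "i \<otimes> (l [^] n) = \<one>"
      using ln unfolding i_def by auto
    have "a = i \<odot>\<^bsub>UP R\<^esub> (l [^] n \<odot>\<^bsub>UP R\<^esub> a)"
      using i l UP_smult_assoc1[OF i(1) _ a, of "l [^] n"] UP_smult_one[OF a] by simp
    also have "\<dots> = b \<otimes>\<^bsub>UP R\<^esub> (i \<odot>\<^bsub>UP R\<^esub> q) \<oplus>\<^bsub>UP R\<^esub> i \<odot>\<^bsub>UP R\<^esub> r"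
    proof -
      have "b \<otimes>\<^bsub>UP R\<^esub> (i \<odot>\<^bsub>UP R\<^esub> q) = (i \<odot>\<^bsub>UP R\<^esub> q) \<otimes>\<^bsub>UP R\<^esub> b"
        by (rule UP_m_comm[OF b(1) UP_smult_closed[OF i(1) qr(1)]])
      also have "\<dots> = i \<odot>\<^bsub>UP R\<^esub> (b \<otimes>\<^bsub>UP R\<^esub> q)"
        using UP_smult_assoc2[OF i(1) qr(1) b(1)] UP_m_comm[OF b(1) qr(1)] by simp
      finally show ?thesis
        using UP_smult_r_distr[OF i(1) UP_mult_closed[OF b(1) qr(1)] qr(2)] qr(3) by simp
    qed
    finally have "a = b \<otimes>\<^bsub>UP R\<^esub> (i \<odot>\<^bsub>UP R\<^esub> q) \<oplus>\<^bsub>UP R\<^esub> i \<odot>\<^bsub>UP R\<^esub> r" .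
    moreover have "i \<odot>\<^bsub>UP R\<^esub> r = \<zero>\<^bsub>UP R\<^esub> \<or> deg R (i \<odot>\<^bsub>UP R\<^esub> r) < deg R b"
      using qr(4) deg_smult_decr[OF i(1) qr(2)] i(1) by (auto simp: smult_r_null)
    ultimately show "\<exists>q r. q \<in> carrier (UP R) \<and> r \<in> carrier (UP R) \<and>
        a = b \<otimes>\<^bsub>UP R\<^esub> q \<oplus>\<^bsub>UP R\<^esub> r \<and> (r = \<zero>\<^bsub>UP R\<^esub> \<or> deg R r < deg R b)"
      using UP_smult_closed[OF i(1)] qr(1,2) by blast
  qed
  have "\<one>\<^bsub>UP R\<^esub> gcdof\<^bsub>UP R\<^esub> f g"
  proof (unfold isgcd_def, intro conjI ballI impI)
    show "\<one>\<^bsub>UP R\<^esub> divides\<^bsub>UP R\<^esub> f" "\<one>\<^bsub>UP R\<^esub> divides\<^bsub>UP R\<^esub> g"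
      using f g UP_l_one by (metis dividesI)+
  next
    fix c assume "c \<in> carrier (UP R)" "c divides\<^bsub>UP R\<^esub> f \<and> c divides\<^bsub>UP R\<^esub> g"
    then have "c \<in> Units (UP R)"
      using cop by blast
    then obtain c' where "c' \<in> carrier (UP R)" "c \<otimes>\<^bsub>UP R\<^esub> c' = \<one>\<^bsub>UP R\<^esub>"
      unfolding Units_def by blast
    then show "c divides\<^bsub>UP R\<^esub> \<one>\<^bsub>UP R\<^esub>"
      by (metis dividesI)
  qed
  then have "PIdl\<^bsub>UP R\<^esub> \<one>\<^bsub>UP R\<^esub> = PIdl\<^bsub>UP R\<^esub> f <+>\<^bsub>UP R\<^esub> PIdl\<^bsub>UP R\<^esub> g"
    using E.ideal_sum_iff_gcd[OF f g] by simp
  moreover have "\<one>\<^bsub>UP R\<^esub> \<in> PIdl\<^bsub>UP R\<^esub> \<one>\<^bsub>UP R\<^esub>"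
    by (rule P.cgenideal_self[OF UP_one_closed])
  ultimately have "\<one>\<^bsub>UP R\<^esub> \<in> PIdl\<^bsub>UP R\<^esub> f <+>\<^bsub>UP R\<^esub> PIdl\<^bsub>UP R\<^esub> g"
    by blast
  then obtain a b where "a \<in> carrier (UP R)" "b \<in> carrier (UP R)"
      "\<one>\<^bsub>UP R\<^esub> = a \<otimes>\<^bsub>UP R\<^esub> f \<oplus>\<^bsub>UP R\<^esub> b \<otimes>\<^bsub>UP R\<^esub> g"
    unfolding cgenideal_def set_add_def' by auto
  then show ?thesis
    by (intro bexI[of _ a] bexI[of _ b]) simp_all
qed

lemma UP_simps:
  "carrier (UP R) = up R" "\<one>\<^bsub>UP R\<^esub> = (\<lambda>i. if i = 0 then \<one>\<^bsub>R\<^esub> else \<zero>\<^bsub>R\<^esub>)"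
  "\<zero>\<^bsub>UP R\<^esub> = (\<lambda>i. \<zero>\<^bsub>R\<^esub>)"
  by (simp_all add: UP_def)

lemma coeff_UP: "p \<in> carrier (UP R) \<Longrightarrow> UnivPoly.coeff (UP R) p n = p n"
  by (simp add: UP_def)

locale valued_subfield = nonarch_field +
  fixes F :: "'a set"
  assumes subfield_F: "subfield F Kbar"
begin

abbreviation "O\<^sub>F \<equiv> carrier (val_ring v F)"
abbreviation "k\<^sub>F \<equiv> residue_field v F"

lemma val_ring_simps:
  "O\<^sub>F = {x \<in> F. v x \<le> 1}" "\<one>\<^bsub>val_ring v F\<^esub> = 1" "\<zero>\<^bsub>val_ring v F\<^esub> = 0"
  "x \<otimes>\<^bsub>val_ring v F\<^esub> y = x * y" "x \<oplus>\<^bsub>val_ring v F\<^esub> y = x + y"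
  by (auto simp: val_ring_def ring_of_type_algebra_def)

sublocale O: cring "val_ring v F"
  by (rule residue_field_is_field(1)[OF subfield_F nonarch])

sublocale M: maximalideal "val_ideal v F" "val_ring v F"
  by (rule residue_field_is_field(2)[OF subfield_F nonarch])

sublocale k: field k\<^sub>F
  by (rule residue_field_is_field(3)[OF subfield_F nonarch])

sublocale U: UP_domain k\<^sub>F "UP k\<^sub>F"
  by unfold_locales auto

abbreviation residue :: "'a \<Rightarrow> 'a set" where
  "residue x \<equiv> val_ideal v F +>\<^bsub>val_ring v F\<^esub> x"

sublocale red: ring_hom_ring "val_ring v F" k\<^sub>F residue
  using M.rcos_ring_hom_ring unfolding residue_field_def .

lemma val_ring_minus: "x \<in> O\<^sub>F \<Longrightarrow> \<ominus>\<^bsub>val_ring v F\<^esub> x = - x"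
proof -
  assume x: "x \<in> O\<^sub>F"
  interpret R: field "Kbar :: 'a ring"
    by (rule field_from_type_algebra)
  have "\<ominus>\<^bsub>Kbar\<^esub> x = - x"
    by (intro R.minus_equality) (auto simp: ring_of_type_algebra_def)
  then have "- x \<in> F"
    using subringE(5)[OF subfieldE(1)[OF subfield_F]] x by (metis val_ring_simps(1) mem_Collect_eq)
  with x show ?thesis
    by (intro O.minus_equality) (auto simp: val_ring_simps)
qed

lemma residue_eq_iff:
  assumes "x \<in> O\<^sub>F" "y \<in> O\<^sub>F"
  shows "residue x = residue y \<longleftrightarrow> v (x - y) < 1"
proof -
  have "x \<ominus>\<^bsub>val_ring v F\<^esub> y = x - y"
    using assms by (simp add: a_minus_def val_ring_minus val_ring_simps)
  moreover have "x \<ominus>\<^bsub>val_ring v F\<^esub> y \<in> O\<^sub>F"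
    using assms by simp
  ultimately have "x \<ominus>\<^bsub>val_ring v F\<^esub> y \<in> val_ideal v F \<longleftrightarrow> v (x - y) < 1"
    by (simp add: val_ideal_def val_ring_simps)
  then show ?thesis
    using O.quotient_eq_iff_same_a_r_cos[OF M.ideal_axioms assms] by simp
qed

lemma val_ring_sum:
  assumes "finite A" "\<And>i. i \<in> A \<Longrightarrow> f i \<in> O\<^sub>F"
  shows "finsum (val_ring v F) f A = sum f A"
  using assms by (induction A) (auto simp: O.finsum_insert val_ring_simps)

abbreviation "reduce \<equiv> reduce_poly v F"

lemma poly_over_val_ring: "f \<in> poly_over O\<^sub>F \<longleftrightarrow> f \<in> poly_over F \<and> integral_poly f"
  by (auto simp: poly_over_def integral_poly_def val_ring_simps)

lemma poly_overD: "f \<in> poly_over S \<Longrightarrow> coeff f i \<in> S"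
  by (simp add: poly_over_def)

lemma reduce_closed [simp]: "f \<in> poly_over O\<^sub>F \<Longrightarrow> reduce f \<in> carrier (UP k\<^sub>F)"
proof -
  assume f: "f \<in> poly_over O\<^sub>F"
  have "reduce f \<in> up k\<^sub>F"
  proof (rule mem_upI)
    show "\<exists>n. bound \<zero>\<^bsub>k\<^sub>F\<^esub> n (reduce f)"
      using red.hom_zero by (intro exI[of _ "degree f"] bound.intro)
        (simp add: reduce_poly_def coeff_eq_0 val_ring_simps)
  qed (use f in \<open>simp add: reduce_poly_def poly_over_def\<close>)
  then show ?thesis
    by (simp only: UP_simps)
qed

lemma val_ring_mem:
  "0 \<in> O\<^sub>F" "1 \<in> O\<^sub>F" "x \<in> O\<^sub>F \<Longrightarrow> y \<in> O\<^sub>F \<Longrightarrow> x * y \<in> O\<^sub>F" "x \<in> O\<^sub>F \<Longrightarrow> y \<in> O\<^sub>F \<Longrightarrow> x + y \<in> O\<^sub>F"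
  "x \<in> O\<^sub>F \<Longrightarrow> - x \<in> O\<^sub>F"
  using O.zero_closed O.one_closed O.m_closed[of x y] O.a_closed[of x y] O.a_inv_closed[of x]
  by (simp_all add: val_ring_simps(2-5) val_ring_minus)

lemma val_ring_sum_mem:
  assumes "\<And>i. i \<in> A \<Longrightarrow> f i \<in> O\<^sub>F"
  shows "sum f A \<in> O\<^sub>F"
  using assms by (induction A rule: infinite_finite_induct) (simp_all add: val_ring_mem)

lemma poly_over_mult: "f \<in> poly_over O\<^sub>F \<Longrightarrow> g \<in> poly_over O\<^sub>F \<Longrightarrow> f * g \<in> poly_over O\<^sub>F"
  by (simp add: poly_over_def coeff_mult val_ring_sum_mem val_ring_mem(3))

lemma poly_over_add: "f \<in> poly_over O\<^sub>F \<Longrightarrow> g \<in> poly_over O\<^sub>F \<Longrightarrow> f + g \<in> poly_over O\<^sub>F"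
  by (simp add: poly_over_def val_ring_mem(4))

lemma poly_over_0_1: "0 \<in> poly_over O\<^sub>F" "1 \<in> poly_over O\<^sub>F"
  by (simp_all add: poly_over_def coeff_1 val_ring_mem)

lemma reduce_add:
  assumes "f \<in> poly_over O\<^sub>F" "g \<in> poly_over O\<^sub>F"
  shows "reduce (f + g) = reduce f \<oplus>\<^bsub>UP k\<^sub>F\<^esub> reduce g"
proof (rule U.up_eqI)
  fix n
  show "UnivPoly.coeff (UP k\<^sub>F) (reduce (f + g)) n =
      UnivPoly.coeff (UP k\<^sub>F) (reduce f \<oplus>\<^bsub>UP k\<^sub>F\<^esub> reduce g) n"
    using assms poly_over_add[OF assms] red.hom_add[OF poly_overD[OF assms(1)] poly_overD[OF assms(2)], of n n]
      U.coeff_add[OF reduce_closed reduce_closed, of f g n]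
    by (simp add: coeff_UP[OF reduce_closed])
      (simp add: reduce_poly_def val_ring_simps(5))
qed (intro reduce_closed poly_over_add U.UP_a_closed assms)+

lemma reduce_mult:
  assumes "f \<in> poly_over O\<^sub>F" "g \<in> poly_over O\<^sub>F"
  shows "reduce (f * g) = reduce f \<otimes>\<^bsub>UP k\<^sub>F\<^esub> reduce g"
proof (rule U.up_eqI)
  fix n
  have mem: "coeff f i * coeff g (n - i) \<in> O\<^sub>F" for i
    using assms by (intro val_ring_mem poly_overD)
  have "residue (\<Sum>i\<le>n. coeff f i * coeff g (n - i)) =
      residue (finsum (val_ring v F) (\<lambda>i. coeff f i * coeff g (n - i)) {..n})"
    using mem by (subst val_ring_sum) auto
  also have "\<dots> = finsum k\<^sub>F (residue \<circ> (\<lambda>i. coeff f i * coeff g (n - i))) {..n}"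
    using mem by (intro red.hom_finsum) auto
  also have "\<dots> = finsum k\<^sub>F (\<lambda>i. reduce f i \<otimes>\<^bsub>k\<^sub>F\<^esub> reduce g (n - i)) {..n}"
    using assms red.hom_mult
    by (intro k.finsum_cong') (auto simp: reduce_poly_def poly_overD val_ring_simps(4))
  finally show "UnivPoly.coeff (UP k\<^sub>F) (reduce (f * g)) n =
      UnivPoly.coeff (UP k\<^sub>F) (reduce f \<otimes>\<^bsub>UP k\<^sub>F\<^esub> reduce g) n"
    using assms poly_over_mult[OF assms] U.coeff_mult[OF reduce_closed reduce_closed, of f g n]
    by (simp add: coeff_UP[OF reduce_closed]) (simp add: reduce_poly_def coeff_mult)
qed (intro reduce_closed poly_over_mult U.UP_mult_closed assms)+

lemma reduce_1: "reduce 1 = \<one>\<^bsub>UP k\<^sub>F\<^esub>"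
  using red.hom_one red.hom_zero by (simp add: reduce_poly_def UP_simps(2) fun_eq_iff val_ring_simps(2,3) coeff_1)

lemma reduce_eq_iff:
  assumes "f \<in> poly_over O\<^sub>F" "g \<in> poly_over O\<^sub>F"
  shows "reduce f = reduce g \<longleftrightarrow> small_poly (f - g)"
  using residue_eq_iff[OF poly_overD[OF assms(1)] poly_overD[OF assms(2)]]
  unfolding reduce_poly_def fun_eq_iff small_poly_def coeff_diff by blast

lemma reduce_0: "reduce 0 = \<zero>\<^bsub>UP k\<^sub>F\<^esub>"
  using red.hom_zero by (simp add: reduce_poly_def UP_simps(3) val_ring_simps(3))

lemma reduce_eq_0_iff: "f \<in> poly_over O\<^sub>F \<Longrightarrow> reduce f = \<zero>\<^bsub>UP k\<^sub>F\<^esub> \<longleftrightarrow> small_poly f"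
  using reduce_eq_iff[of f 0] poly_over_0_1 by (simp add: reduce_0)

lemma residue_eq_0_iff: "x \<in> O\<^sub>F \<Longrightarrow> residue x = \<zero>\<^bsub>k\<^sub>F\<^esub> \<longleftrightarrow> v x < 1"
  using residue_eq_iff[of x 0] red.hom_zero val_ring_mem(1) by (simp add: val_ring_simps)

lemma reduce_lift:
  assumes p: "p \<in> carrier (UP k\<^sub>F)"
  obtains f where "f \<in> poly_over O\<^sub>F" "reduce f = p" "degree f \<le> deg k\<^sub>F p"
proof -
  have "\<exists>x \<in> O\<^sub>F. residue x = p i" for i
  proof -
    have "p i \<in> carrier k\<^sub>F"
      using p by (metis coeff_UP U.coeff_closed)
    then have "p i \<in> a_rcosets\<^bsub>val_ring v F\<^esub> val_ideal v F"
      by (simp only: residue_field_def FactRing_def partial_object.simps)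
    then show ?thesis
      unfolding A_RCOSETS_def' by blast
  qed
  then have "\<forall>i. \<exists>x. x \<in> O\<^sub>F \<and> residue x = p i"
    by blast
  from choice[OF this] obtain c where c: "\<And>i. c i \<in> O\<^sub>F" "\<And>i. residue (c i) = p i"
    by blast
  \<comment> \<open>The chosen lifts of zero coefficients may be nonzero, so the sum is cut at the
    degree of \<open>p\<close>.\<close>
  define f where "f = (\<Sum>i\<le>deg k\<^sub>F p. monom (c i) i)"
  have coeff_f: "coeff f n = (if n \<le> deg k\<^sub>F p then c n else 0)" for n
    unfolding f_def coeff_sum coeff_monom by simp
  show ?thesis
  proof
    show "f \<in> poly_over O\<^sub>F"
      using c(1) val_ring_mem(1) by (auto simp: poly_over_def coeff_f)
    show "degree f \<le> deg k\<^sub>F p"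
      by (intro degree_le) (auto simp: coeff_f)
    have "p n = \<zero>\<^bsub>k\<^sub>F\<^esub>" if "n > deg k\<^sub>F p" for n
      using U.deg_aboveD[OF that p] p by (simp add: coeff_UP)
    then show "reduce f = p"
      using c(2) red.hom_zero by (auto simp: reduce_poly_def coeff_f fun_eq_iff val_ring_simps)
  qed
qed

lemma deg_reduce_le:
  assumes "f \<in> poly_over O\<^sub>F" "degree f \<le> d"
  shows "deg k\<^sub>F (reduce f) \<le> d"
proof (rule U.deg_aboveI)
  fix m assume "d < m"
  then have "reduce f m = \<zero>\<^bsub>k\<^sub>F\<^esub>"
    using assms(2) red.hom_zero by (simp add: reduce_poly_def coeff_eq_0 val_ring_simps)
  then show "UnivPoly.coeff (UP k\<^sub>F) (reduce f) m = \<zero>\<^bsub>k\<^sub>F\<^esub>"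
    using assms(1) by (simp add: coeff_UP)
qed (rule reduce_closed[OF assms(1)])

lemma deg_reduce_ge:
  assumes "f \<in> poly_over O\<^sub>F" "v (coeff f d) = 1"
  shows "deg k\<^sub>F (reduce f) \<ge> d"
proof (rule U.deg_belowI)
  have "reduce f d \<noteq> \<zero>\<^bsub>k\<^sub>F\<^esub>"
    using assms(2) residue_eq_0_iff[OF poly_overD[OF assms(1)], of d] by (simp add: reduce_poly_def)
  then show "UnivPoly.coeff (UP k\<^sub>F) (reduce f) d \<noteq> \<zero>\<^bsub>k\<^sub>F\<^esub>"
    using assms(1) by (simp add: coeff_UP)
qed (rule reduce_closed[OF assms(1)])

text \<open>An exact integral Bezout identity survives reduction, so the reductions have no common
  factor and 1 serves as the cancelled factor.\<close>

lemma quotient_degree_reduce: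
  assumes fg: "f \<in> poly_over O\<^sub>F" "g \<in> poly_over O\<^sub>F" "degree f \<le> d" "degree g \<le> d"
      "v (coeff f d) = 1 \<or> v (coeff g d) = 1"
    and ab: "a \<in> poly_over O\<^sub>F" "b \<in> poly_over O\<^sub>F" "a * f + b * g = 1"
  shows "quotient_degree k\<^sub>F (reduce f) (reduce g) d"
proof -
  have bezout: "reduce a \<otimes>\<^bsub>UP k\<^sub>F\<^esub> reduce f \<oplus>\<^bsub>UP k\<^sub>F\<^esub> reduce b \<otimes>\<^bsub>UP k\<^sub>F\<^esub> reduce g = \<one>\<^bsub>UP k\<^sub>F\<^esub>"
    using fg ab by (metis reduce_1 reduce_add reduce_mult poly_over_mult)
  have unit: "c \<in> Units (UP k\<^sub>F)"
    if c: "c \<in> carrier (UP k\<^sub>F)" "c divides\<^bsub>UP k\<^sub>F\<^esub> reduce f" "c divides\<^bsub>UP k\<^sub>F\<^esub> reduce g" for c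
  proof -
    obtain r s where rs: "r \<in> carrier (UP k\<^sub>F)" "reduce f = c \<otimes>\<^bsub>UP k\<^sub>F\<^esub> r"
        "s \<in> carrier (UP k\<^sub>F)" "reduce g = c \<otimes>\<^bsub>UP k\<^sub>F\<^esub> s"
      using c(2,3) by (auto simp: factor_def)
    define t where "t = reduce a \<otimes>\<^bsub>UP k\<^sub>F\<^esub> r \<oplus>\<^bsub>UP k\<^sub>F\<^esub> reduce b \<otimes>\<^bsub>UP k\<^sub>F\<^esub> s"
    have "c \<otimes>\<^bsub>UP k\<^sub>F\<^esub> t = \<one>\<^bsub>UP k\<^sub>F\<^esub>"
      using bezout rs c(1) ab unfolding t_def
      by (simp add: U.P.r_distr U.P.m_lcomm)
    moreover have "t \<in> carrier (UP k\<^sub>F)"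
      using rs ab unfolding t_def by simp
    ultimately show ?thesis
      using c(1) U.P.m_comm[of t c] by (auto simp: Units_def)
  qed
  have d: "d = max (deg k\<^sub>F (reduce f)) (deg k\<^sub>F (reduce g))"
    using deg_reduce_le[of f d] deg_reduce_le[of g d] deg_reduce_ge[of f d] deg_reduce_ge[of g d] fg
    by fastforce
  have one: "\<one>\<^bsub>UP k\<^sub>F\<^esub> \<noteq> \<zero>\<^bsub>UP k\<^sub>F\<^esub>"
    by (rule domain.one_not_zero[OF U.UP_domain])
  have eq: "reduce f = \<one>\<^bsub>UP k\<^sub>F\<^esub> \<otimes>\<^bsub>UP k\<^sub>F\<^esub> reduce f" "reduce g = \<one>\<^bsub>UP k\<^sub>F\<^esub> \<otimes>\<^bsub>UP k\<^sub>F\<^esub> reduce g"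
    using fg by (simp_all only: U.UP_l_one[OF reduce_closed])
  have "\<forall>c \<in> carrier (UP k\<^sub>F). c divides\<^bsub>UP k\<^sub>F\<^esub> reduce f \<and> c divides\<^bsub>UP k\<^sub>F\<^esub> reduce g \<longrightarrow>
      c \<in> Units (UP k\<^sub>F)"
    by (intro ballI impI, elim conjE, rule unit)
  then show ?thesis
    unfolding quotient_degree_def
    by (intro bexI[OF _ U.UP_one_closed] bexI[OF _ reduce_closed[OF fg(1)]]
        bexI[OF _ reduce_closed[OF fg(2)]] conjI one eq d)
qed


end

subsection \<open>Good reduction and integral lifts\<close>

context valued_subfield
begin

text \<open>Lifts the cancelled reductions together with their Bezout identity, so that the
  comparison of representations can be carried out by congruences of integral polynomials, without
  the residue field.\<close>

lemma quotient_degree_lift: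
  assumes fg: "f \<in> poly_over O\<^sub>F" "g \<in> poly_over O\<^sub>F"
    and qd: "quotient_degree k\<^sub>F (reduce f) (reduce g) d"
  obtains h f' g' a b where
    "integral_poly h" "integral_poly f'" "integral_poly g'" "integral_poly a" "integral_poly b"
    "\<not> small_poly h" "small_poly (f - h * f')" "small_poly (g - h * g')"
    "degree f' \<le> d" "degree g' \<le> d" "v (coeff f' d) = 1 \<or> v (coeff g' d) = 1"
    "small_poly (a * f' + b * g' - 1)"
proof -
  obtain H P Q where HPQ: "H \<in> carrier (UP k\<^sub>F)" "P \<in> carrier (UP k\<^sub>F)" "Q \<in> carrier (UP k\<^sub>F)"
      "H \<noteq> \<zero>\<^bsub>UP k\<^sub>F\<^esub>" "reduce f = H \<otimes>\<^bsub>UP k\<^sub>F\<^esub> P" "reduce g = H \<otimes>\<^bsub>UP k\<^sub>F\<^esub> Q"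
      "\<And>c. c \<in> carrier (UP k\<^sub>F) \<Longrightarrow> c divides\<^bsub>UP k\<^sub>F\<^esub> P \<Longrightarrow> c divides\<^bsub>UP k\<^sub>F\<^esub> Q \<Longrightarrow> c \<in> Units (UP k\<^sub>F)"
      "d = max (deg k\<^sub>F P) (deg k\<^sub>F Q)"
    using qd unfolding quotient_degree_def by blast
  obtain A B where AB: "A \<in> carrier (UP k\<^sub>F)" "B \<in> carrier (UP k\<^sub>F)"
      "A \<otimes>\<^bsub>UP k\<^sub>F\<^esub> P \<oplus>\<^bsub>UP k\<^sub>F\<^esub> B \<otimes>\<^bsub>UP k\<^sub>F\<^esub> Q = \<one>\<^bsub>UP k\<^sub>F\<^esub>"
    using k.UP_bezout[OF HPQ(2,3,7)] by blast
  obtain h where h: "h \<in> poly_over O\<^sub>F" "reduce h = H"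
    using reduce_lift[OF HPQ(1)] .
  obtain f' where f': "f' \<in> poly_over O\<^sub>F" "reduce f' = P" "degree f' \<le> deg k\<^sub>F P"
    using reduce_lift[OF HPQ(2)] .
  obtain g' where g': "g' \<in> poly_over O\<^sub>F" "reduce g' = Q" "degree g' \<le> deg k\<^sub>F Q"
    using reduce_lift[OF HPQ(3)] .
  obtain a where a: "a \<in> poly_over O\<^sub>F" "reduce a = A"
    using reduce_lift[OF AB(1)] .
  obtain b where b: "b \<in> poly_over O\<^sub>F" "reduce b = B"
    using reduce_lift[OF AB(2)] .
  show ?thesis
  proof
    show "integral_poly h" "integral_poly f'" "integral_poly g'" "integral_poly a" "integral_poly b"
      using h f' g' a b poly_over_val_ring by blast+
    show "\<not> small_poly h"
      using reduce_eq_0_iff[OF h(1)] h(2) HPQ(4) by blast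
    have "reduce f = reduce (h * f')" "reduce g = reduce (h * g')"
      using reduce_mult[OF h(1) f'(1)] reduce_mult[OF h(1) g'(1)] h(2) f'(2) g'(2) HPQ(5,6)
      by presburger+
    then show "small_poly (f - h * f')" "small_poly (g - h * g')"
      using reduce_eq_iff fg h f' g' poly_over_mult by blast+
    show "degree f' \<le> d" "degree g' \<le> d"
      using f'(3) g'(3) HPQ(8) by linarith+
    have af: "a * f' \<in> poly_over O\<^sub>F" and bg: "b * g' \<in> poly_over O\<^sub>F"
      using a b f' g' poly_over_mult by blast+
    have "reduce (a * f' + b * g') = reduce 1"
      unfolding reduce_add[OF af bg] reduce_mult[OF a(1) f'(1)] reduce_mult[OF b(1) g'(1)] reduce_1
        a(2) b(2) f'(2) g'(2) by (rule AB(3))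
    then show "small_poly (a * f' + b * g' - 1)"
      using reduce_eq_iff[OF poly_over_add[OF af bg] poly_over_0_1(2)] by blast
    have unit: "v (coeff p n) = 1"
      if "p \<in> poly_over O\<^sub>F" "reduce p \<noteq> \<zero>\<^bsub>UP k\<^sub>F\<^esub>" "n = deg k\<^sub>F (reduce p)" for p n
    proof -
      have "reduce p n \<noteq> \<zero>\<^bsub>k\<^sub>F\<^esub>"
        using U.lcoeff_nonzero2[OF reduce_closed[OF that(1)] that(2)] that(3)
          coeff_UP[OF reduce_closed[OF that(1)]] by metis
      then have "\<not> v (coeff p n) < 1"
        using residue_eq_0_iff[OF poly_overD[OF that(1)], of n] by (simp add: reduce_poly_def)
      moreover have "v (coeff p n) \<le> 1"
        using that(1) by (simp add: poly_over_val_ring integral_poly_def)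
      ultimately show ?thesis
        by linarith
    qed
    have "P \<noteq> \<zero>\<^bsub>UP k\<^sub>F\<^esub> \<or> Q \<noteq> \<zero>\<^bsub>UP k\<^sub>F\<^esub>"
    proof (rule ccontr)
      assume "\<not> ?thesis"
      then have "\<zero>\<^bsub>UP k\<^sub>F\<^esub> = \<one>\<^bsub>UP k\<^sub>F\<^esub>"
        using AB by simp
      then show False
        using domain.one_not_zero[OF U.UP_domain] by simp
    qed
    moreover have "deg k\<^sub>F \<zero>\<^bsub>UP k\<^sub>F\<^esub> = 0"
      by (rule U.deg_zero)
    \<comment> \<open>The zero polynomial has degree 0 here. If \<open>d = 0\<close>, the maximum
      may be attained by it, so a nonzero polynomial of degree \<open>d\<close> has to be
      selected.\<close>
    ultimately consider "P \<noteq> \<zero>\<^bsub>UP k\<^sub>F\<^esub>" "d = deg k\<^sub>F P" | "Q \<noteq> \<zero>\<^bsub>UP k\<^sub>F\<^esub>" "d = deg k\<^sub>F Q"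
      using HPQ(8) by (metis bot_nat_0.extremum max.absorb1 max.absorb2 nle_le)
    then show "v (coeff f' d) = 1 \<or> v (coeff g' d) = 1"
      using unit[OF f'(1), of d] unit[OF g'(1), of d] f'(2) g'(2) by cases blast+
  qed
qed

end

section \<open>From an arbitrary representation to the coprime one\<close>

context nonarch_field
begin

text \<open>Gauss's lemma read from the top: \<open>n\<close> is the degree of the reduction of
  \<open>s\<close>, and it adds to the degree \<open>d\<close> of the reduction of
  \<open>f\<close>.\<close>

lemma unit_coeff_mult:
  assumes f: "integral_poly f" "degree f \<le> d" "v (coeff f d) = 1"
    and s: "integral_poly s" "\<not> small_poly s"
  obtains n where "v (coeff s n) = 1" "\<And>i. i > n \<Longrightarrow> v (coeff s i) < 1" "v (coeff (f * s) (d + n)) = 1"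
proof -
  define N where "N = {i. \<not> v (coeff s i) < 1}"
  have "N \<subseteq> {..degree s}"
    unfolding N_def by (auto intro!: le_degree)
  then have N: "finite N" "N \<noteq> {}"
    using s(2) finite_subset by (auto simp: N_def small_poly_def)
  define n where "n = Max N"
  have "n \<in> N" "\<And>i. i > n \<Longrightarrow> i \<notin> N"
    using N unfolding n_def by (simp, meson Max_ge leD)
  then have n: "v (coeff s n) = 1" "\<And>i. i > n \<Longrightarrow> v (coeff s i) < 1"
    using s(1) unfolding N_def integral_poly_def by (metis antisym_conv1 mem_Collect_eq, blast)
  have "coeff (f * s) (d + n) = (\<Sum>i\<in>{..d + n} - {d}. coeff f i * coeff s (d + n - i)) + coeff f d * coeff s n"
    by (simp add: coeff_mult sum.remove[of "{..d + n}" d])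
  moreover have "v (\<Sum>i\<in>{..d + n} - {d}. coeff f i * coeff s (d + n - i)) < 1"
  proof (rule v_sum_less)
    fix i assume i: "i \<in> {..d + n} - {d}"
    show "v (coeff f i * coeff s (d + n - i)) < 1"
    proof (cases "i < d")
      case True
      then have "v (coeff s (d + n - i)) < 1"
        by (intro n) auto
      moreover have "v (coeff f i) * v (coeff s (d + n - i)) \<le> v (coeff s (d + n - i))"
        using f(1) by (intro mult_left_le_one_le) (auto simp: integral_poly_def)
      ultimately show ?thesis
        by (simp add: v_mult)
    next
      case False
      with i f(2) show ?thesis
        by (simp add: coeff_eq_0)
    qed
  qed simp
  moreover have "v (coeff f d * coeff s n) = 1"
    using f(3) n(1) by (simp add: v_mult)
  ultimately have "v (coeff (f * s) (d + n)) = 1"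
    using v_add_eq by metis
  with n show ?thesis
    by (rule that)
qed

lemma scale_to_integral:
  assumes "f \<noteq> 0 \<or> g \<noteq> 0"
  obtains c where "c \<noteq> 0" "integral_poly (smult c f)" "integral_poly (smult c g)"
    "\<not> small_poly (smult c f) \<or> \<not> small_poly (smult c g)"
proof -
  define S where "S = range (coeff f) \<union> range (coeff g)"
  have "range (coeff p) \<subseteq> insert 0 (coeff p ` {..degree p})" for p :: "'a poly"
    using le_degree by fastforce
  then have S: "finite S" "S \<noteq> {}"
    unfolding S_def by (meson finite_Un finite_subset finite_atMost finite_imageI finite_insert) auto
  define M where "M = Max (v ` S)"
  have le: "v x \<le> M" if "x \<in> S" for x
    unfolding M_def using S that by simp
  have "M \<in> v ` S"
    unfolding M_def using S by simp
  then obtain m where m: "m \<in> S" "v m = M"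
    by blast
  obtain x where "x \<in> S" "x \<noteq> 0"
    using assms unfolding S_def by (metis UnI1 UnI2 leading_coeff_0_iff rangeI)
  then have "m \<noteq> 0"
    using le[of x] m(2) v_pos[of x] v_pos[of m] by linarith
  have scaled: "v (inverse m * x) \<le> 1" if "x \<in> S" for x
    using le[OF that] m(2) \<open>m \<noteq> 0\<close> v_pos[of m] by (simp add: v_divide flip: divide_inverse_commute)
  show ?thesis
  proof
    show "inverse m \<noteq> 0"
      using \<open>m \<noteq> 0\<close> by simp
    show "integral_poly (smult (inverse m) f)" "integral_poly (smult (inverse m) g)"
      using scaled by (auto simp: integral_poly_def S_def)
    obtain i where "m = coeff f i \<or> m = coeff g i"
      using m(1) unfolding S_def by blast
    then have "v (coeff (smult (inverse m) f) i) = 1 \<or> v (coeff (smult (inverse m) g) i) = 1"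
      using \<open>m \<noteq> 0\<close> by auto
    then show "\<not> small_poly (smult (inverse m) f) \<or> \<not> small_poly (smult (inverse m) g)"
      unfolding small_poly_def by (metis less_irrefl)
  qed
qed

end

context valued_subfield
begin

text \<open>The representation in \<open>good_reduction\<close> may carry a common factor before or
  after reduction, whereas the norm equation concerns the coprime pair. Gauss's lemma cancels
  \<open>h\<close> from the cross product, so the reduction of the rescaled coprime pair is a
  multiple of the cancelled pair \<open>(f', g')\<close>. A degree count shows that the multiplier
  is a constant.\<close>

lemma good_reduction_imp_good_pair:
  assumes "good_reduction v F (Fract f0 g0)" "g0 \<noteq> 0" "coprime f0 g0"
    and d: "d = max (degree f0) (degree g0)"
  obtains c where "c \<noteq> 0" "good_pair d (smult c f0) (smult c g0)"
proof -
  have "ratfun_degree (Fract f0 g0) = d"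
    using assms by (simp add: ratfun_degree_Fract)
  then obtain f g where fg: "f \<in> poly_over O\<^sub>F" "g \<in> poly_over O\<^sub>F" "g \<noteq> 0" "Fract f0 g0 = Fract f g"
      "quotient_degree k\<^sub>F (reduce f) (reduce g) d"
    using assms(1) unfolding good_reduction_def by auto
  obtain h f' g' a b where *:
    "integral_poly h" "integral_poly f'" "integral_poly g'" "integral_poly a" "integral_poly b"
    "\<not> small_poly h" "small_poly (f - h * f')" "small_poly (g - h * g')"
    "degree f' \<le> d" "degree g' \<le> d" "v (coeff f' d) = 1 \<or> v (coeff g' d) = 1"
    "small_poly (a * f' + b * g' - 1)"
    using quotient_degree_lift[OF fg(1,2,5)] .
  obtain c where c: "c \<noteq> 0" "integral_poly (smult c f0)" "integral_poly (smult c g0)"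
      "\<not> small_poly (smult c f0) \<or> \<not> small_poly (smult c g0)"
    using scale_to_integral[of f0 g0] assms(2) by blast
  define F0 where "F0 = smult c f0"
  define G0 where "G0 = smult c g0"
  have FG: "integral_poly F0" "integral_poly G0" "\<not> small_poly F0 \<or> \<not> small_poly G0"
      "degree F0 \<le> d" "degree G0 \<le> d"
    using c d unfolding F0_def G0_def by auto
  have "f0 * g = f * g0"
    using fg(3,4) assms(2) by (simp add: eq_fract)
  then have eq: "F0 * g = f * G0"
    unfolding F0_def G0_def by simp
  have "h * (F0 * g' - f' * G0) = G0 * (f - h * f') - F0 * (g - h * g')"
    using eq by (simp add: algebra_simps)
  moreover have "small_poly (G0 * (f - h * f') - F0 * (g - h * g'))"
    by (intro small_poly_diff[OF small_poly_mult small_poly_mult] FG *)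
  ultimately have "small_poly (h * (F0 * g' - f' * G0))"
    by simp
  then have cross: "small_poly (F0 * g' - f' * G0)"
    using small_poly_multD[of h "F0 * g' - f' * G0"] FG *
    by (auto intro!: integral_poly_diff integral_poly_mult)
  then have cross': "small_poly (f' * G0 - F0 * g')"
    using small_poly_diff_commute by blast
  \<comment> \<open>The multiplier: as \<open>a * f' + b * g'\<close> reduces to 1, the small cross
    product yields \<open>f' * s = F0\<close> and \<open>g' * s = G0\<close> modulo small
    polynomials.\<close>
  define s where "s = a * F0 + b * G0"
  have s: "integral_poly s"
    unfolding s_def using FG * by (intro integral_poly_add integral_poly_mult)
  have "f' * s - F0 = F0 * (a * f' + b * g' - 1) + b * (f' * G0 - F0 * g')"
    unfolding s_def by (simp add: algebra_simps)
  then have sF: "small_poly (f' * s - F0)"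
    using FG * cross' by (auto intro!: small_poly_add small_poly_mult)
  have "g' * s - G0 = G0 * (a * f' + b * g' - 1) + a * (F0 * g' - f' * G0)"
    unfolding s_def by (simp add: algebra_simps)
  then have sG: "small_poly (g' * s - G0)"
    using FG * cross by (auto intro!: small_poly_add small_poly_mult)
  have s_nz: "\<not> small_poly s"
  proof
    assume "small_poly s"
    then have "small_poly (f' * s - (f' * s - F0))" "small_poly (g' * s - (g' * s - G0))"
      using sF sG * by (blast intro: small_poly_mult small_poly_diff)+
    then show False
      using FG(3) by simp
  qed
  \<comment> \<open>A top unit coefficient of \<open>s\<close> at \<open>n\<close> produces a unit
    coefficient of \<open>G\<close> at \<open>d + n\<close>, but \<open>G\<close> has degree at most
    \<open>d\<close>. So \<open>n = 0\<close>, and \<open>s\<close> reduces to a nonzero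
    constant.\<close>
  have key: "v (coeff s 0) = 1 \<and> (\<forall>i>0. v (coeff s i) < 1) \<and> v (coeff G d) = 1"
    if g: "integral_poly g" "degree g \<le> d" "v (coeff g d) = 1"
      and G: "degree G \<le> d" "small_poly (g * s - G)" for g G
  proof -
    obtain n where n: "v (coeff s n) = 1" "\<And>i. i > n \<Longrightarrow> v (coeff s i) < 1" "v (coeff (g * s) (d + n)) = 1"
      using unit_coeff_mult[OF g s s_nz] by blast
    have "v (coeff (g * s - G) (d + n)) < 1"
      using G(2) by (simp only: small_poly_def)
    then have "v (coeff (g * s) (d + n) - coeff G (d + n)) < 1"
      by simp
    then have less: "v (coeff G (d + n) - coeff (g * s) (d + n)) < 1"
      by (metis minus_diff_eq v_minus)
    have "v (coeff G (d + n)) = 1"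
      using v_add_eq[of "coeff G (d + n) - coeff (g * s) (d + n)" "coeff (g * s) (d + n)"] less n(3)
      by simp
    then have "coeff G (d + n) \<noteq> 0"
      by auto
    then have "n = 0"
      using G(1) le_degree[of G "d + n"] by simp
    with n \<open>v (coeff G (d + n)) = 1\<close> show ?thesis
      by simp
  qed
  have unit: "v (coeff s 0) = 1" "\<And>i. i > 0 \<Longrightarrow> v (coeff s i) < 1" "v (coeff F0 d) = 1 \<or> v (coeff G0 d) = 1"
    using key[of f' F0] key[of g' G0] * FG sF sG by blast+
  \<comment> \<open>Dividing by this constant turns \<open>a * F0 + b * G0 = s\<close> into a Bezout
    identity for the coprime pair itself.\<close>
  define t where "t = inverse (coeff s 0)"
  have t: "v t = 1" "t * coeff s 0 = 1"
    using unit(1) v_inverse[of "coeff s 0"] v_pos[of "coeff s 0"] unfolding t_def by simp_all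
  have "integral_poly (smult t a)" "integral_poly (smult t b)"
    using * t(1) by (auto simp: integral_poly_def v_mult)
  moreover have "smult t a * F0 + smult t b * G0 - 1 = smult t s - 1"
    unfolding s_def by (simp add: smult_add_right)
  moreover have "small_poly (smult t s - 1)"
    unfolding small_poly_def
  proof
    fix i
    show "v (coeff (smult t s - 1) i) < 1"
      using t unit(2)[of i] by (cases "i = 0") (auto simp: coeff_1 v_mult)
  qed
  ultimately have "good_pair d F0 G0"
    unfolding good_pair_def using FG unit(3) by metis
  with c(1) that show ?thesis
    unfolding F0_def G0_def by blast
qed

lemma good_reduction_Fract:
  assumes fg: "f \<in> poly_over O\<^sub>F" "g \<in> poly_over O\<^sub>F" "g \<noteq> 0" "degree f \<le> d" "degree g \<le> d"
      "v (coeff f d) = 1 \<or> v (coeff g d) = 1"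
    and ab: "a \<in> poly_over O\<^sub>F" "b \<in> poly_over O\<^sub>F" "a * f + b * g = 1"
  shows "good_reduction v F (Fract f g)"
proof -
  have "coprime f g"
  proof (rule coprimeI)
    fix c assume "c dvd f" "c dvd g"
    then have "c dvd a * f + b * g"
      by simp
    then show "is_unit c"
      using ab(3) by simp
  qed
  moreover have "max (degree f) (degree g) = d"
  proof -
    have "coeff f d \<noteq> 0 \<or> coeff g d \<noteq> 0"
      using fg(6) by auto
    then show ?thesis
      using fg(4,5) le_degree[of f d] le_degree[of g d] by linarith
  qed
  ultimately have "ratfun_degree (Fract f g) = d"
    using fg(3) by (simp add: ratfun_degree_Fract)
  then show ?thesis
    unfolding good_reduction_def using fg quotient_degree_reduce[OF fg(1,2,4,5,6) ab] by blast
qed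

end

subsection \<open>Conjugation\<close>

text \<open>The degree \<open>d\<close> homogenization of \<open>f\<close> at the pair
  \<open>(p, q)\<close>, that is, \<open>f (p / q)\<close> with the denominator \<open>q ^ d\<close>
  cleared.\<close>

definition hom_subst :: "nat \<Rightarrow> 'a::field poly \<Rightarrow> 'a poly \<Rightarrow> 'a poly \<Rightarrow> 'a poly" where
  "hom_subst d f p q = (\<Sum>i\<le>d. smult (coeff f i) (p ^ i * q ^ (d - i)))"

lemma poly_at_Fract:
  assumes "degree f \<le> d" "q \<noteq> 0"
  shows "poly_at f (Fract p q) = Fract (hom_subst d f p q) (q ^ d)"
proof -
  have pow: "Fract p q ^ i = Fract (p ^ i) (q ^ i)" for i
    using assms(2) by (induction i) (auto simp: One_fract_def)
  have term_eq: "Fract [:c:] 1 * Fract p q ^ i = Fract (smult c (p ^ i * q ^ (d - i))) (q ^ d)"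
    if "i \<le> d" for c i
  proof -
    have "q ^ d = q ^ i * q ^ (d - i)"
      using that by (simp flip: power_add)
    then show ?thesis
      using assms(2) by (simp add: pow eq_fract mult_ac)
  qed
  have sum_Fract: "(\<Sum>i\<in>A. Fract (g i) r) = Fract (\<Sum>i\<in>A. g i) r" if "r \<noteq> 0" for A :: "nat set" and g and r :: "'a poly"
    by (induction A rule: infinite_finite_induct)
      (use that in \<open>auto simp: Zero_fract_def eq_fract algebra_simps\<close>)
  have "poly_at f (Fract p q) = (\<Sum>i\<le>d. Fract [:coeff f i:] 1 * Fract p q ^ i)"
  proof -
    have "degree (map_poly (\<lambda>c. Fract [:c:] 1) f) \<le> d"
      using assms(1) map_poly_degree_leq order_trans by blast
    then show ?thesis
      unfolding poly_at_def poly_altdef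
      by (subst sum.mono_neutral_left[of "{..d}"])
        (auto simp: coeff_eq_0 coeff_map_poly Zero_fract_def)
  qed
  also have "\<dots> = (\<Sum>i\<le>d. Fract (smult (coeff f i) (p ^ i * q ^ (d - i))) (q ^ d))"
    by (intro sum.cong term_eq) auto
  also have "\<dots> = Fract (hom_subst d f p q) (q ^ d)"
    unfolding hom_subst_def using assms(2) by (intro sum_Fract) auto
  finally show ?thesis .
qed

lemma hom_eval_hom_subst:
  assumes "degree f \<le> d" "degree p \<le> 1" "degree q \<le> 1"
  shows "hom_eval d (hom_subst d f p q) x y = hom_eval d f (hom_eval 1 p x y) (hom_eval 1 q x y)"
proof -
  have "hom_eval d (p ^ i * q ^ (d - i)) x y = hom_eval 1 p x y ^ i * hom_eval 1 q x y ^ (d - i)"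
    if "i \<le> d" for i
    using hom_eval_mult[OF degree_power_le_exponent[OF assms(2)] degree_power_le_exponent[OF assms(3)], of i "d - i" x y] that
    by (simp only: hom_eval_power[OF assms(2)] hom_eval_power[OF assms(3)] le_add_diff_inverse)
  then show ?thesis
    unfolding hom_subst_def hom_eval_sum hom_eval_smult hom_eval_sum_upto[OF assms(1)]
    by (intro sum.cong) (auto simp: mult.assoc)
qed

lemma degree_hom_subst:
  assumes "degree p \<le> 1" "degree q \<le> 1"
  shows "degree (hom_subst d f p q) \<le> d"
  unfolding hom_subst_def
proof (intro degree_sum_le)
  fix i assume "i \<in> {..d}"
  have "degree (p ^ i * q ^ (d - i)) \<le> i + (d - i)"
    by (meson add_mono assms degree_power_le_exponent degree_mult_le order_trans)
  then show "degree (smult (coeff f i) (p ^ i * q ^ (d - i))) \<le> d"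
    using \<open>i \<in> {..d}\<close> by (metis atMost_iff degree_smult_le le_add_diff_inverse order_trans)
qed simp

text \<open>Coprimality of a degree \<open>d\<close> lift, phrased by its zeros so that invertible
  linear changes in source and target visibly preserve it. Over an algebraically closed field it
  returns coprimality and the exact degree.\<close>

definition base_point_free :: "nat \<Rightarrow> 'a::field poly \<Rightarrow> 'a poly \<Rightarrow> bool" where
  "base_point_free d f g \<longleftrightarrow> degree f \<le> d \<and> degree g \<le> d \<and>
     (\<forall>x y. hom_eval d f x y = 0 \<and> hom_eval d g x y = 0 \<longrightarrow> x = 0 \<and> y = 0)"

lemma coprime_imp_base_point_free:
  fixes f g :: "'a::field poly"
  assumes "coprime f g" "d = max (degree f) (degree g)" "g \<noteq> 0"
  shows "base_point_free d f g"
  unfolding base_point_free_def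
proof (intro conjI allI impI)
  fix x y assume *: "hom_eval d f x y = 0 \<and> hom_eval d g x y = 0"
  have "y = 0"
  proof (rule ccontr)
    assume "y \<noteq> 0"
    with * have "poly f (x / y) = 0" "poly g (x / y) = 0"
      by (auto simp: hom_eval_def)
    then have "[:- (x / y), 1:] dvd 1"
      using assms(1) by (meson coprime_common_divisor poly_eq_0_iff_dvd)
    then show False
      by (simp add: is_unit_iff_degree)
  qed
  moreover have "coeff f d \<noteq> 0 \<or> coeff g d \<noteq> 0"
    using assms(2,3) by (cases "degree f \<le> degree g") (auto simp: max_def)
  ultimately show "x = 0" "y = 0"
    using * by (auto simp: hom_eval_def)
qed (use assms(2) in auto)

text \<open>If one polynomial vanished, the other would have a nonzero coefficient in degree
  \<open>d\<close>, hence be nonconstant and have a root, which would be a common zero.\<close>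

lemma base_point_freeD:
  fixes f g :: "'a::alg_closed_field poly"
  assumes "base_point_free d f g" "d \<ge> 1"
  shows "f \<noteq> 0" "g \<noteq> 0" "coprime f g" "max (degree f) (degree g) = d"
proof -
  have deg: "degree f \<le> d" "degree g \<le> d"
    and bp: "\<And>x y. hom_eval d f x y = 0 \<Longrightarrow> hom_eval d g x y = 0 \<Longrightarrow> x = 0 \<and> y = 0"
    using assms(1) unfolding base_point_free_def by blast+
  have coeffs: "coeff f d \<noteq> 0 \<or> coeff g d \<noteq> 0"
    using bp[of 1 0] by (auto simp: hom_eval_def)
  have no_root: "poly f x \<noteq> 0 \<or> poly g x \<noteq> 0" for x
    using bp[of x 1] by (auto simp: hom_eval_def)
  have root: "\<exists>x. poly p x = 0" if "coeff p d \<noteq> 0" for p :: "'a poly"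
    using that assms(2) alg_closed_imp_poly_has_root[of p] le_degree[of p d] by auto
  show "f \<noteq> 0" "g \<noteq> 0"
    using root[of f] root[of g] coeffs no_root by force+
  show "max (degree f) (degree g) = d"
    using deg coeffs le_degree[of f d] le_degree[of g d] by linarith
  show "coprime f g"
  proof (rule coprimeI)
    fix c assume c: "c dvd f" "c dvd g"
    then have "c \<noteq> 0"
      using \<open>f \<noteq> 0\<close> by auto
    moreover have "\<not> degree c > 0"
      using alg_closed_imp_poly_has_root[of c] c no_root by (metis dvdE mult_zero_left poly_mult)
    ultimately show "is_unit c"
      by (simp add: is_unit_iff_degree)
  qed
qed

text \<open>Describes the conjugate by its lift along \<open>H X\<close> instead of by coefficients.
  The inverse is the adjugate, and adjugate times \<open>H\<close> is the determinant times the
  identity; homogeneity turns this scalar into the factor with exponent \<open>d\<close>.\<close>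

lemma mobius_conjugate:
  fixes P Q :: "'a::alg_closed_field poly"
  assumes PQ: "base_point_free d P Q" "d \<ge> 1" and det: "a * e - b * c \<noteq> 0"
  obtains f g where "base_point_free d f g"
    "ratfun_comp (ratfun_comp (mobius a b c e) (Fract P Q)) (mobius e (- b) (- c) a) = Fract f g"
    "\<And>x y. hom_eval d f (a * x + b * y) (c * x + e * y) =
             (a * e - b * c) ^ d * (a * hom_eval d P x y + b * hom_eval d Q x y)"
    "\<And>x y. hom_eval d g (a * x + b * y) (c * x + e * y) =
             (a * e - b * c) ^ d * (c * hom_eval d P x y + e * hom_eval d Q x y)"
proof -
  note PQ' = PQ[unfolded base_point_free_def]
  have Q: "Q \<noteq> 0"
    using base_point_freeD[OF PQ] by blast
  define f where "f = smult a P + smult b Q"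
  define g where "g = smult c P + smult e Q"
  have deg: "degree f \<le> d" "degree g \<le> d"
    using PQ' unfolding f_def g_def by (auto intro!: degree_add_le order_trans[OF degree_smult_le])
  have hom_fg: "hom_eval d f x y = a * hom_eval d P x y + b * hom_eval d Q x y"
    "hom_eval d g x y = c * hom_eval d P x y + e * hom_eval d Q x y" for x y
    by (simp_all add: f_def g_def hom_eval_add hom_eval_smult)
  have inv: "x = 0 \<and> y = 0" if "a * x + b * y = 0" "c * x + e * y = 0" for x y
  proof -
    have eq: "(a * e - b * c) * x = e * (a * x + b * y) - b * (c * x + e * y)"
      "(a * e - b * c) * y = a * (c * x + e * y) - c * (a * x + b * y)"
      by (simp_all add: algebra_simps)
    have "(a * e - b * c) * x = 0" "(a * e - b * c) * y = 0"
      unfolding eq that by simp_all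
    with det show ?thesis
      by simp
  qed
  have fg: "base_point_free d f g"
    unfolding base_point_free_def hom_fg
  proof (intro conjI allI impI deg)
    fix x y
    assume *: "a * hom_eval d P x y + b * hom_eval d Q x y = 0 \<and>
      c * hom_eval d P x y + e * hom_eval d Q x y = 0"
    then have "hom_eval d P x y = 0 \<and> hom_eval d Q x y = 0"
      by (intro inv) blast+
    then show "x = 0" "y = 0"
      using PQ' by blast+
  qed
  then have g0: "g \<noteq> 0"
    using base_point_freeD PQ(2) by blast
  have "poly_at [:e, c:] (Fract P Q) = Fract g Q" "poly_at [:b, a:] (Fract P Q) = Fract f Q"
    using Q by (simp_all add: f_def g_def eq_fract algebra_simps)
  moreover have "Fract g Q \<noteq> 0"
    using g0 Q by (simp add: Zero_fract_def eq_fract)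
  moreover have "[:e, c:] \<noteq> 0"
    using det by auto
  ultimately have comp1: "ratfun_comp (mobius a b c e) (Fract P Q) = Fract f g"
    unfolding mobius_def using g0 Q by (simp add: ratfun_comp_Fract eq_fract)
  define p where "p = [:- b, e:]"
  define q where "q = [:a, - c:]"
  have pq: "degree p \<le> 1" "degree q \<le> 1" "q \<noteq> 0"
    using det unfolding p_def q_def by auto
  define f' where "f' = hom_subst d f p q"
  define g' where "g' = hom_subst d g p q"
  have hom': "hom_eval d f' x y = hom_eval d f (e * x - b * y) (a * y - c * x)"
    "hom_eval d g' x y = hom_eval d g (e * x - b * y) (a * y - c * x)" for x y
    unfolding f'_def g'_def hom_eval_hom_subst[OF deg(1) pq(1,2)] hom_eval_hom_subst[OF deg(2) pq(1,2)]
    by (simp_all only: p_def q_def hom_eval_linear) (simp_all add: algebra_simps)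
  have "x = 0 \<and> y = 0" if "e * x - b * y = 0" "a * y - c * x = 0" for x y
  proof -
    have eq: "(a * e - b * c) * x = a * (e * x - b * y) + b * (a * y - c * x)"
      "(a * e - b * c) * y = c * (e * x - b * y) + e * (a * y - c * x)"
      by (simp_all add: algebra_simps)
    have "(a * e - b * c) * x = 0" "(a * e - b * c) * y = 0"
      unfolding eq that by simp_all
    with det show ?thesis
      by simp
  qed
  then have bpf': "base_point_free d f' g'"
    using fg degree_hom_subst[OF pq(1,2)] unfolding base_point_free_def hom'
    unfolding f'_def g'_def by blast
  then have "g' \<noteq> 0"
    using base_point_freeD PQ(2) by blast
  have "poly_at f (Fract p q) = Fract f' (q ^ d)" "poly_at g (Fract p q) = Fract g' (q ^ d)"
    unfolding f'_def g'_def using poly_at_Fract deg pq(3) by blast+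
  moreover have "Fract g' (q ^ d) \<noteq> 0"
    using \<open>g' \<noteq> 0\<close> pq(3) by (simp add: Zero_fract_def eq_fract)
  ultimately have "ratfun_comp (Fract f g) (Fract p q) = Fract f' g'"
    using g0 \<open>g' \<noteq> 0\<close> pq(3) by (simp add: ratfun_comp_Fract eq_fract)
  then have "ratfun_comp (ratfun_comp (mobius a b c e) (Fract P Q)) (mobius e (- b) (- c) a) = Fract f' g'"
    unfolding comp1 by (simp add: mobius_def p_def q_def)
  moreover have "hom_eval d f' (a * x + b * y) (c * x + e * y) = (a * e - b * c) ^ d * hom_eval d f x y"
    "hom_eval d g' (a * x + b * y) (c * x + e * y) = (a * e - b * c) ^ d * hom_eval d g x y" for x y
  proof -
    have "e * (a * x + b * y) - b * (c * x + e * y) = (a * e - b * c) * x"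
      "a * (c * x + e * y) - c * (a * x + b * y) = (a * e - b * c) * y"
      by (simp_all add: algebra_simps)
    then show "hom_eval d f' (a * x + b * y) (c * x + e * y) = (a * e - b * c) ^ d * hom_eval d f x y"
      "hom_eval d g' (a * x + b * y) (c * x + e * y) = (a * e - b * c) ^ d * hom_eval d g x y"
      unfolding hom' using hom_eval_scale deg by metis+
  qed
  ultimately show ?thesis
    using that[OF bpf'] unfolding hom_fg by blast
qed

text \<open>Transports \<open>good_pair_hom_eval\<close> back along \<open>H\<close>. The constant
  \<kappa> absorbs the rescaling \<open>t\<close> of the coprime pair and the power of the
  determinant.\<close>

lemma good_conjugate_norm:
  fixes v :: "'a::alg_closed_field \<Rightarrow> real"
  assumes "nonarch_abs v" "subfield F Kbar"
    and PQ: "base_point_free d P Q" "d \<ge> 1" and det: "a * e - b * c \<noteq> 0"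
    and good: "good_reduction v F
      (ratfun_comp (ratfun_comp (mobius a b c e) (Fract P Q)) (mobius e (- b) (- c) a))"
  obtains \<kappa> where "\<kappa> > 0"
    "\<And>x y. max (v (a * hom_eval d P x y + b * hom_eval d Q x y)) (v (c * hom_eval d P x y + e * hom_eval d Q x y))
      = \<kappa> * max (v (a * x + b * y)) (v (c * x + e * y)) ^ d"
proof -
  interpret valued_subfield v F
    by (intro valued_subfield.intro nonarch_field.intro valued_subfield_axioms.intro assms(1,2))
  obtain f g where fg: "base_point_free d f g"
    "ratfun_comp (ratfun_comp (mobius a b c e) (Fract P Q)) (mobius e (- b) (- c) a) = Fract f g"
    "\<And>x y. hom_eval d f (a * x + b * y) (c * x + e * y) =
             (a * e - b * c) ^ d * (a * hom_eval d P x y + b * hom_eval d Q x y)"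
    "\<And>x y. hom_eval d g (a * x + b * y) (c * x + e * y) =
             (a * e - b * c) ^ d * (c * hom_eval d P x y + e * hom_eval d Q x y)"
    using mobius_conjugate[OF PQ det] by blast
  obtain t where t: "t \<noteq> 0" "good_pair d (smult t f) (smult t g)"
    using good_reduction_imp_good_pair[of f g d] good base_point_freeD[OF fg(1) PQ(2)] fg(2) by metis
  define D where "D = v t * v (a * e - b * c) ^ d"
  have "D > 0"
    using t(1) det unfolding D_def by simp
  show ?thesis
  proof
    show "1 / D > 0"
      using \<open>D > 0\<close> by simp
    fix x y
    define p where "p = a * hom_eval d P x y + b * hom_eval d Q x y"
    define q where "q = c * hom_eval d P x y + e * hom_eval d Q x y"
    have "max (D * v p) (D * v q) = max (v (a * x + b * y)) (v (c * x + e * y)) ^ d"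
      using good_pair_hom_eval[OF t(2), of "a * x + b * y" "c * x + e * y"]
      by (simp add: hom_eval_smult fg(3,4) v_mult v_power D_def p_def q_def mult.assoc)
    moreover have "max (D * v p) (D * v q) = D * max (v p) (v q)"
      using \<open>D > 0\<close> by (simp add: max_mult_distrib_left)
    ultimately have "D * max (v p) (v q) = max (v (a * x + b * y)) (v (c * x + e * y)) ^ d"
      by simp
    then show "max (v p) (v q) = 1 / D * max (v (a * x + b * y)) (v (c * x + e * y)) ^ d"
      using \<open>D > 0\<close> by (simp add: field_simps)
  qed
qed

text \<open>Iterating \<open>T\<close> raises the ratio of two values of \<open>u\<close> to the powers \<open>d ^ n\<close>, which stay bounded.\<close>

lemma power_cocycle_const:
  fixes u :: "'b \<Rightarrow> real"
  assumes T: "\<And>x. x \<in> A \<Longrightarrow> T x \<in> A" and u: "\<And>x. x \<in> A \<Longrightarrow> m \<le> u x \<and> u x \<le> M" "0 < m"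
    and uT: "\<And>x. x \<in> A \<Longrightarrow> u (T x) = \<kappa> * u x ^ d" and "d \<ge> 2" "\<kappa> > 0" "x \<in> A" "y \<in> A"
  shows "u x = u y"
proof -
  have "u x \<le> u y" if xy: "x \<in> A" "y \<in> A" for x y
  proof (rule ccontr)
    assume "\<not> u x \<le> u y"
    have pos: "u z > 0" if "z \<in> A" for z
      using u(1)[OF that] u(2) by linarith
    define r where "r = u x / u y"
    have r: "r > 1"
      using \<open>\<not> u x \<le> u y\<close> pos[OF xy(2)] unfolding r_def by simp
    have in_A: "(T ^^ n) z \<in> A" if "z \<in> A" for z n
      using that T by (induction n) auto
    have ratio: "u ((T ^^ n) x) / u ((T ^^ n) y) = r ^ (d ^ n)" for n
    proof (induction n)
      case (Suc n)
      have "u ((T ^^ Suc n) x) / u ((T ^^ Suc n) y) = (u ((T ^^ n) x) / u ((T ^^ n) y)) ^ d"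
        using uT in_A xy \<open>\<kappa> > 0\<close> by (simp add: power_divide)
      also have "\<dots> = r ^ (d ^ Suc n)"
        by (simp add: Suc power_mult[symmetric] mult.commute)
      finally show ?case .
    qed (simp add: r_def)
    obtain n where n: "M / m < r ^ n"
      using real_arch_pow[OF r] by blast
    have "n \<le> d ^ n"
      using \<open>d \<ge> 2\<close> less_exp[of n] power_mono[of 2 d n] by linarith
    then have "M / m < r ^ (d ^ n)"
      using n r power_increasing[of n "d ^ n" r] by linarith
    moreover have "u ((T ^^ n) x) / u ((T ^^ n) y) \<le> M / m"
      using u(1)[OF in_A[OF xy(1)], of n] u(1)[OF in_A[OF xy(2)], of n] u(2)
      by (intro frac_le) auto
    ultimately show False
      using ratio[of n] by linarith
  qed
  then show ?thesis
    using \<open>x \<in> A\<close> \<open>y \<in> A\<close> by (simp add: antisym)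
qed

section \<open>Uniqueness of the norm up to scaling\<close>

context nonarch_field
begin

text \<open>Norms given by invertible matrices are equivalent: Cramer's rule bounds \<open>x\<close>
  and \<open>y\<close> by the unprimed norm.\<close>

lemma linear_norm_le:
  assumes det: "a * e - b * c \<noteq> 0"
  obtains C where "C > 0" "\<And>x y. max (v (a' * x + b' * y)) (v (c' * x + e' * y))
    \<le> C * max (v (a * x + b * y)) (v (c * x + e * y))"
proof -
  define h where "h = v a + v b + v c + v e"
  \<comment> \<open>The summand 1 keeps \<open>h'\<close> positive even if all primed entries
    vanish.\<close>
  define h' where "h' = v a' + v b' + v c' + v e' + 1"
  define D where "D = v (a * e - b * c)"
  have lin: "v (s * x + t * y) \<le> k * m" if "v s \<le> k" "v t \<le> k" "v x \<le> m" "v y \<le> m" for s t x y k m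
  proof -
    have "v (s * x) \<le> k * m" "v (t * y) \<le> k * m"
      unfolding v_mult using that by (auto intro!: mult_mono order_trans[OF v_nonneg])
    then show ?thesis
      using v_add[of "s * x" "t * y"] by linarith
  qed
  have D: "D > 0"
    unfolding D_def using det by simp
  have pos: "v a \<ge> 0" "v b \<ge> 0" "v c \<ge> 0" "v e \<ge> 0" "v a' \<ge> 0" "v b' \<ge> 0" "v c' \<ge> 0" "v e' \<ge> 0"
    by simp_all
  have bound: "max (v (a' * x + b' * y)) (v (c' * x + e' * y))
      \<le> h' * (h * max (v (a * x + b * y)) (v (c * x + e * y)) / D)" for x y
  proof -
    define x1 where "x1 = a * x + b * y"
    define y1 where "y1 = c * x + e * y"
    have "(a * e - b * c) * x = e * x1 + (- b) * y1" "(a * e - b * c) * y = (- c) * x1 + a * y1"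
      unfolding x1_def y1_def by (simp_all add: algebra_simps)
    moreover have "v (e * x1 + (- b) * y1) \<le> h * max (v x1) (v y1)" "v ((- c) * x1 + a * y1) \<le> h * max (v x1) (v y1)"
      using pos by (intro lin; simp add: h_def)+
    ultimately have "D * v x \<le> h * max (v x1) (v y1)" "D * v y \<le> h * max (v x1) (v y1)"
      unfolding D_def by (metis v_mult)+
    then have "v x \<le> h * max (v x1) (v y1) / D" "v y \<le> h * max (v x1) (v y1) / D"
      using D by (simp_all add: field_simps)
    then show ?thesis
      unfolding x1_def[symmetric] y1_def[symmetric]
      using pos by (intro max.boundedI lin) (auto simp: h'_def)
  qed
  have "h > 0"
  proof -
    have "a \<noteq> 0 \<or> b \<noteq> 0"
      using det by auto
    then have "v a > 0 \<or> v b > 0"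
      by simp
    then show ?thesis
      using pos unfolding h_def by linarith
  qed
  moreover have "h' > 0"
    using pos unfolding h'_def by linarith
  ultimately have "h' * h / D > 0"
    using D by simp
  then show ?thesis
    using bound by (intro that[of "h' * h / D"]) (auto simp: mult.assoc)
qed

end

text \<open>The fields \<open>F\<close> and \<open>F'\<close> may be incomparable; the comparison
  takes place on the plane over the ambient field, where both coordinates define norms for the same
  lift.\<close>

lemma good_conjugates_proportional:
  fixes v :: "'a::alg_closed_field \<Rightarrow> real"
  assumes v: "nonarch_abs v" and PQ: "base_point_free d P Q" "d \<ge> 2"
    and 1: "subfield F Kbar" "a * e - b * c \<noteq> 0" "good_reduction v F
      (ratfun_comp (ratfun_comp (mobius a b c e) (Fract P Q)) (mobius e (- b) (- c) a))"
    and 2: "subfield F' Kbar" "a' * e' - b' * c' \<noteq> 0" "good_reduction v F'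
      (ratfun_comp (ratfun_comp (mobius a' b' c' e') (Fract P Q)) (mobius e' (- b') (- c') a'))"
  obtains s where "s > 0" "\<And>x y. max (v (a * x + b * y)) (v (c * x + e * y)) =
    s * max (v (a' * x + b' * y)) (v (c' * x + e' * y))"
proof -
  interpret nonarch_field v
    using v by unfold_locales
  define N where "N x y = max (v (a * x + b * y)) (v (c * x + e * y))" for x y
  define N' where "N' x y = max (v (a' * x + b' * y)) (v (c' * x + e' * y))" for x y
  have "d \<ge> 1"
    using PQ(2) by simp
  obtain k where k: "k > 0" "\<And>x y. N (hom_eval d P x y) (hom_eval d Q x y) = k * N x y ^ d"
    unfolding N_def using good_conjugate_norm[OF v 1(1) PQ(1) \<open>d \<ge> 1\<close> 1(2,3)] by blast
  obtain k' where k': "k' > 0" "\<And>x y. N' (hom_eval d P x y) (hom_eval d Q x y) = k' * N' x y ^ d"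
    unfolding N'_def using good_conjugate_norm[OF v 2(1) PQ(1) \<open>d \<ge> 1\<close> 2(2,3)] by blast
  obtain C where C: "C > 0" "\<And>x y. N x y \<le> C * N' x y"
    unfolding N_def N'_def using linear_norm_le[OF 2(2), of a b c e] by blast
  obtain C' where C': "C' > 0" "\<And>x y. N' x y \<le> C' * N x y"
    unfolding N_def N'_def using linear_norm_le[OF 1(2), of a' b' c' e'] by blast
  have N_0: "N' x y = 0 \<longleftrightarrow> N x y = 0" for x y
  proof -
    have "N x y \<ge> 0" "N' x y \<ge> 0"
      unfolding N_def N'_def by (simp_all add: le_max_iff_disj)
    then show ?thesis
      using C(2)[of x y] C'(2)[of x y] by auto
  qed
  \<comment> \<open>The nonzero vectors. \<open>N\<close> and \<open>N'\<close> vanish at the same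
    vectors, so the ratio \<open>u\<close> is a genuine quotient on \<open>A\<close>, and the norm
    equation shows that the lift maps \<open>A\<close> to itself.\<close>
  define A where "A = {(x, y). N x y \<noteq> 0}"
  define u where "u = (\<lambda>(x, y). N x y / N' x y)"
  have pos: "N x y > 0" "N' x y > 0" if "(x, y) \<in> A" for x y
  proof -
    have "N x y \<ge> 0" "N' x y \<ge> 0"
      unfolding N_def N'_def by (simp_all add: le_max_iff_disj)
    then show "N x y > 0" "N' x y > 0"
      using that N_0[of x y] unfolding A_def by auto
  qed
  have const: "u z = u w" if "z \<in> A" "w \<in> A" for z w
  proof (rule power_cocycle_const[where T = "\<lambda>(x, y). (hom_eval d P x y, hom_eval d Q x y)"
        and A = A and m = "1 / C'" and M = C and \<kappa> = "k / k'" and d = d and u = u])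
    fix z assume z: "z \<in> A"
    obtain x y where [simp]: "z = (x, y)"
      by (cases z)
    show "(case z of (x, y) \<Rightarrow> (hom_eval d P x y, hom_eval d Q x y)) \<in> A"
      using z k by (auto simp: A_def)
    show "1 / C' \<le> u z \<and> u z \<le> C"
      using pos[of x y] z C(2)[of x y] C'(2)[of x y] C(1) C'(1) by (auto simp: u_def field_simps)
    show "u (case z of (x, y) \<Rightarrow> (hom_eval d P x y, hom_eval d Q x y)) = k / k' * u z ^ d"
      by (simp add: u_def k k' power_divide)
  qed (use C' k k' PQ that in auto)
  have "A \<noteq> {}"
  proof -
    have "a \<noteq> 0 \<or> c \<noteq> 0"
      using 1(2) by auto
    then have "v a > 0 \<or> v c > 0"
      by simp
    then have "N 1 0 > 0"
      unfolding N_def by (simp add: less_max_iff_disj)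
    then show ?thesis
      unfolding A_def by force
  qed
  then obtain x0 y0 where z0: "(x0, y0) \<in> A"
    by auto
  show ?thesis
  proof
    show "u (x0, y0) > 0"
      using pos[OF z0] by (simp add: u_def)
    fix x y
    have "N x y = u (x0, y0) * N' x y"
    proof (cases "(x, y) \<in> A")
      case True
      then show ?thesis
        using const[OF z0 True] pos[OF True] by (simp add: u_def field_simps)
    next
      case False
      then show ?thesis
        using N_0[of x y] by (simp add: A_def)
    qed
    then show "max (v (a * x + b * y)) (v (c * x + e * y)) =
        u (x0, y0) * max (v (a' * x + b' * y)) (v (c' * x + e' * y))"
      unfolding N_def N'_def .
  qed
qed

subsection \<open>Fields of definition and value groups\<close>

lemma subfield_Kbar_closed:
  fixes F :: "'a::field set"
  assumes F: "subfield F Kbar"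
  shows "0 \<in> F" "1 \<in> F" "x \<in> F \<Longrightarrow> - x \<in> F" "x \<in> F \<Longrightarrow> y \<in> F \<Longrightarrow> x + y \<in> F"
    "x \<in> F \<Longrightarrow> y \<in> F \<Longrightarrow> x - y \<in> F" "x \<in> F \<Longrightarrow> y \<in> F \<Longrightarrow> x * y \<in> F"
    "x \<in> F \<Longrightarrow> y \<in> F \<Longrightarrow> x / y \<in> F" "x \<in> F \<Longrightarrow> x ^ n \<in> F" "of_nat n \<in> F"
proof -
  interpret R: field "Kbar :: 'a ring"
    by (rule field_from_type_algebra)
  have uminus: "\<ominus>\<^bsub>Kbar\<^esub> x = - x" for x :: 'a
    by (intro R.minus_equality) (auto simp: ring_of_type_algebra_def)
  have inverse: "inv\<^bsub>Kbar\<^esub> x = inverse x" if "x \<noteq> 0" for x :: 'a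
    using that by (intro R.inv_char) (auto simp: ring_of_type_algebra_def)
  show zero: "0 \<in> F" and one: "1 \<in> F" and um: "x \<in> F \<Longrightarrow> - x \<in> F" for x
    using subringE[OF subfieldE(1)[OF F]] uminus by (auto simp: ring_of_type_algebra_def)
  show add: "x \<in> F \<Longrightarrow> y \<in> F \<Longrightarrow> x + y \<in> F" and mult: "x \<in> F \<Longrightarrow> y \<in> F \<Longrightarrow> x * y \<in> F" for x y
    using subringE[OF subfieldE(1)[OF F]] by (auto simp: ring_of_type_algebra_def)
  show "x \<in> F \<Longrightarrow> y \<in> F \<Longrightarrow> x - y \<in> F"
    using add[OF _ um, of x y] by simp
  have "inverse x \<in> F" if "x \<in> F" for x
  proof (cases "x = 0")
    case False
    then show ?thesis
      using R.subfield_m_inv(1)[OF F, of x] that inverse[of x]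
      by (auto simp: ring_of_type_algebra_def)
  qed (use zero in simp)
  then show "x \<in> F \<Longrightarrow> y \<in> F \<Longrightarrow> x / y \<in> F"
    unfolding divide_inverse using mult by blast
  show "x \<in> F \<Longrightarrow> x ^ n \<in> F"
    by (induction n) (auto intro: one mult)
  show "of_nat n \<in> F"
    by (induction n) (auto intro: zero one add)
qed

text \<open>
  Geometrically: the disk of centre \<open>a\<close> and radius \<open>v c\<close> has a centre in \<open>F\<close> and its radius in \<open>v ` F\<close>.
\<close>

lemma (in nonarch_field) disk_defined_over:
  assumes F: "subfield F Kbar" and mem: "\<alpha> \<in> F" "\<beta> \<in> F" "\<gamma> \<in> F" "\<delta> \<in> F"
    and det: "\<alpha> * \<delta> - \<beta> * \<gamma> \<noteq> 0" and s: "s > 0"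
    and norm: "\<And>x y. max (v (\<alpha> * x + \<beta> * y)) (v (\<gamma> * x + \<delta> * y)) = s * max (v (x - a * y)) (v (c * y))"
  obtains t u where "t \<in> F" "u \<in> F" "v (a - t) \<le> v c" "v u = v c"
proof -
  have max_s: "max (v \<alpha>) (v \<gamma>) = s"
    using norm[of 1 0] by simp
  have center: "max (v (\<alpha> * a + \<beta>)) (v (\<gamma> * a + \<delta>)) = s * v c"
    using norm[of a 1] by (simp add: max_def)
  \<comment> \<open>Here \<open>(k, l)\<close> is a row of the matrix whose first entry attains the
    maximum \<open>s\<close>. The point \<open>- l / k\<close> that this row sends to 0 is the
    centre. At the vector \<open>(- l, k)\<close> only the other row contributes, up to sign the
    determinant, so the norm there gives \<open>v c\<close> as the absolute value of the determinant
    divided by \<open>k * k\<close>.\<close>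
  have key: "\<exists>t \<in> F. \<exists>u \<in> F. v (a - t) \<le> v c \<and> v u = v c"
    if k: "k \<in> F" "l \<in> F" "v k = s" "v (k * a + l) \<le> s * v c"
      and H: "max (v (\<alpha> * (- l) + \<beta> * k)) (v (\<gamma> * (- l) + \<delta> * k)) = v (\<alpha> * \<delta> - \<beta> * \<gamma>)" for k l
  proof -
    have "k \<noteq> 0"
      using k(3) s by auto
    have le: "v (- l - a * k) \<le> v (c * k)"
    proof -
      have "v (- l - a * k) = v (k * a + l)"
        using v_minus[of "k * a + l"] by (simp add: algebra_simps)
      then show ?thesis
        using k(3,4) by (simp add: v_mult mult.commute)
    qed
    have "v (\<alpha> * \<delta> - \<beta> * \<gamma>) = v k * v (c * k)"
      using norm[of "- l" k] H le k(3) by (simp add: max_def)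
    then have "v ((\<alpha> * \<delta> - \<beta> * \<gamma>) / (k * k)) = v c"
      using \<open>k \<noteq> 0\<close> by (simp add: v_mult v_divide)
    moreover have "v (a - - l / k) \<le> v c"
    proof -
      have "a - (- l / k) = (k * a + l) / k"
        using \<open>k \<noteq> 0\<close> by (simp add: field_simps)
      then show ?thesis
        using k(3,4) s by (simp add: v_divide field_simps)
    qed
    moreover have "- l / k \<in> F" "(\<alpha> * \<delta> - \<beta> * \<gamma>) / (k * k) \<in> F"
      using k mem by (simp_all add: subfield_Kbar_closed[OF F])
    ultimately show ?thesis
      by blast
  qed
  consider "v \<alpha> = s" | "v \<gamma> = s"
    using max_s by (auto simp: max_def split: if_splits)
  then have "\<exists>t \<in> F. \<exists>u \<in> F. v (a - t) \<le> v c \<and> v u = v c"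
  proof cases
    case 1
    have "max (v (\<alpha> * (- \<beta>) + \<beta> * \<alpha>)) (v (\<gamma> * (- \<beta>) + \<delta> * \<alpha>)) = v (\<alpha> * \<delta> - \<beta> * \<gamma>)"
      by (simp add: algebra_simps)
    then show ?thesis
      using key[of \<alpha> \<beta>] mem center 1 by simp
  next
    case 2
    have H: "max (v (\<alpha> * (- \<delta>) + \<beta> * \<gamma>)) (v (\<gamma> * (- \<delta>) + \<delta> * \<gamma>)) = v (\<alpha> * \<delta> - \<beta> * \<gamma>)"
      using v_minus[of "\<alpha> * \<delta> - \<beta> * \<gamma>"] by (simp add: algebra_simps)
    show ?thesis
      using center by (intro key[OF mem(3,4) 2 _ H]) linarith
  qed
  then show thesis
    using that by blast
qed

section \<open>Degrees of extensions and value groups\<close>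

locale value_group = nonarch_field +
  fixes K :: "'a set"
  assumes subfield_K: "subfield K Kbar"
begin

lemmas K_closed = subfield_Kbar_closed[OF subfield_K]

text \<open>The order of \<open>root B (v x)\<close> modulo the value group of \<open>K\<close> is exactly \<open>B\<close>.\<close>

definition not_power :: "nat \<Rightarrow> 'a \<Rightarrow> bool" where
  "not_power B x \<longleftrightarrow> (\<forall>n. n \<ge> 2 \<longrightarrow> n dvd B \<longrightarrow> root n (v x) \<notin> v ` K)"

lemma not_power_iff:
  "not_power B x \<longleftrightarrow> (\<forall>n k. n \<ge> 2 \<longrightarrow> n dvd B \<longrightarrow> k \<in> K \<longrightarrow> v x \<noteq> v k ^ n)"
proof -
  have "root n (v x) = v k \<longleftrightarrow> v x = v k ^ n" if "n \<ge> 2" for n k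
  proof
    assume "root n (v x) = v k"
    then show "v x = v k ^ n"
      using that real_root_pow_pos2[of n "v x"] by simp
  qed (use that in \<open>simp add: real_root_power_cancel\<close>)
  then show ?thesis
    unfolding not_power_def image_iff by metis
qed

text \<open>The hypothesis excludes roots of degree dividing \<open>B\<close> only, so
  \<open>j\<close> is first replaced by \<open>g = gcd j B\<close>, using Bezout. Then
  \<open>v x\<close> would be the \<open>n\<close>-th power of a value of \<open>K\<close>, where
  \<open>n = B / g\<close> is at least 2 because \<open>g <= j < B\<close>.\<close>

lemma power_notin_value_group:
  assumes B: "not_power B x" "x \<in> K" "v y ^ B = v x" and j: "0 < j" "j < B" and "k \<in> K"
  shows "v y ^ j \<noteq> v k"
proof
  assume eq: "v y ^ j = v k"
  have nz: "v y \<noteq> 0"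
  proof
    assume "v y = 0"
    then have "v x = v 0 ^ B"
      using B(3) by simp
    moreover have "B \<ge> 2"
      using j by linarith
    ultimately show False
      using B(1) K_closed(1) dvd_refl[of B] unfolding not_power_iff by blast
  qed
  obtain r s where rs: "j * r = B * s + gcd j B"
    using bezout_nat[of j B] j by auto
  define g where "g = gcd j B"
  obtain n where n: "B = g * n"
    using gcd_dvd2[of j B] unfolding g_def by blast
  have "g \<le> j"
    unfolding g_def using j by (simp add: gcd_le1_nat)
  then have "n \<ge> 2"
    using n j by (cases n rule: nat.exhaust) (auto simp: Suc_le_eq intro: gr0I)
  have "v k ^ r = v x ^ s * v y ^ g"
  proof -
    have "v k ^ r = v y ^ (B * s + g)"
      using rs unfolding g_def by (metis eq power_mult)
    then show ?thesis
      by (simp add: power_add power_mult B(3))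
  qed
  moreover have "v x \<noteq> 0"
    using nz B(3) by (metis power_not_zero)
  ultimately have "v y ^ g = v (k ^ r / x ^ s)"
    by (simp add: v_divide v_power)
  then have "v x = v (k ^ r / x ^ s) ^ n"
    using B(3) n by (simp add: power_mult)
  moreover have "k ^ r / x ^ s \<in> K"
    using \<open>k \<in> K\<close> B(2) by (intro K_closed(7,8))
  ultimately show False
    using B(1) \<open>n \<ge> 2\<close> n unfolding not_power_iff by (metis dvd_triv_right)
qed

sublocale R: field "Kbar :: 'a ring"
  by (rule field_from_type_algebra)

lemma Kbar_simps:
  "carrier (Kbar :: 'a ring) = UNIV" "x \<otimes>\<^bsub>Kbar\<^esub> y = x * y" "x \<oplus>\<^bsub>Kbar\<^esub> y = x + y" "\<zero>\<^bsub>Kbar\<^esub> = (0 :: 'a)"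
  by (simp_all add: ring_of_type_algebra_def)

text \<open>Nonzero multiples of different powers of \<open>y\<close> by elements of
  \<open>K\<close> have different absolute values. So nothing cancels in a linear combination: a
  nonzero element of the span has the absolute value of one of its terms.\<close>

lemma dimension_ge:
  assumes x: "not_power B x" "x \<in> K" "v y ^ B = v x" "y \<noteq> 0"
    and L: "subfield L Kbar" "y \<in> L" "R.dimension n K L"
  shows "B \<le> n"
proof -
  have distinct_values: "v (k * y ^ i) \<noteq> v (l * y ^ j)"
    if "k \<in> K" "l \<in> K" "k \<noteq> 0" "l \<noteq> 0" "i < j" "j < B" for i j k l
  proof
    assume "v (k * y ^ i) = v (l * y ^ j)"
    moreover have "v y ^ j = v y ^ i * v y ^ (j - i)"
      using that by (simp flip: power_add)
    ultimately have "v y ^ (j - i) = v (k / l)"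
      using that x(4) by (simp add: v_mult v_power v_divide field_simps)
    then show False
      using power_notin_value_group[OF x(1-3), of "j - i" "k / l"] that K_closed by auto
  qed
  have Span: "\<exists>i \<in> set js. \<exists>k \<in> K. k \<noteq> 0 \<and> v z = v (k * y ^ i)"
    if "distinct js" "set js \<subseteq> {..<B}" "z \<in> R.Span K (map ((^) y) js)" "z \<noteq> 0" for js z
    using that
  proof (induction js arbitrary: z)
    case (Cons j js)
    obtain k w where kw: "k \<in> K" "w \<in> R.Span K (map ((^) y) js)" "z = k * y ^ j + w"
      using Cons.prems(3) R.line_extension_mem_iff by (auto simp: Kbar_simps)
    show ?case
    proof (cases "w = 0 \<or> k = 0")
      case True
      then show ?thesis
        using Cons kw by auto
    next
      case False
      then obtain i l where il: "i \<in> set js" "l \<in> K" "l \<noteq> 0" "v w = v (l * y ^ i)"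
        using Cons.IH[OF _ _ kw(2)] Cons.prems(1,2) by auto
      have "i \<noteq> j" "i < B" "j < B"
        using il(1) Cons.prems(1,2) by auto
      then have "v (k * y ^ j) \<noteq> v w"
        using distinct_values[of k l j i] distinct_values[of l k i j] False kw(1) il by (cases "i < j") auto
      then have "v z = v (k * y ^ j) \<or> v z = v w"
        using v_add_eq[of "k * y ^ j" w] v_add_eq[of w "k * y ^ j"] kw(3)
        by (metis add.commute linorder_neqE_linordered_idom)
      then show ?thesis
        using False kw(1) il by auto
    qed
  qed (simp add: Kbar_simps)
  have "R.independent K (map ((^) y) js)" if "distinct js" "set js \<subseteq> {..<B}" for js
    using that
  proof (induction js)
    case (Cons j js)
    have "y ^ j \<notin> R.Span K (map ((^) y) js)"
    proof
      assume "y ^ j \<in> R.Span K (map ((^) y) js)"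
      then obtain i k where ik: "i \<in> set js" "k \<in> K" "k \<noteq> 0" "v (y ^ j) = v (k * y ^ i)"
        using Span[of js "y ^ j"] Cons.prems x(4) by auto
      moreover have "i \<noteq> j" "i < B" "j < B"
        using ik(1) Cons.prems by auto
      ultimately show False
        using distinct_values[of k 1 i j] distinct_values[of 1 k j i] K_closed(2) by (cases "i < j") auto
    qed
    then show ?case
      using Cons by (auto intro!: R.li_Cons simp: Kbar_simps)
  qed simp
  from this[of "[0..<B]"] have "R.independent K (map ((^) y) [0..<B])"
    by (simp add: lessThan_atLeast0)
  moreover have "set (map ((^) y) [0..<B]) \<subseteq> L"
    using subfield_Kbar_closed(8)[OF L(1,2)] by auto
  ultimately have "length (map ((^) y) [0..<B]) \<le> n"
    using R.independent_length_le_dimension[OF subfield_K L(3)] by blast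
  then show ?thesis
    by simp
qed

lemma not_power_nontrivial:
  assumes "not_power B x" "B \<ge> 2"
  shows "v x \<noteq> 0" "v x \<noteq> 1"
  using assms K_closed(1,2) unfolding not_power_iff
  by (metis dvd_refl v_0 zero_power order_less_le_trans zero_less_numeral,
      metis dvd_refl v_1 power_one)

lemma not_power_inverse: "not_power B x \<Longrightarrow> not_power B (1 / x)"
  unfolding not_power_iff
proof (intro allI impI notI)
  fix n k
  assume *: "\<forall>n k. 2 \<le> n \<longrightarrow> n dvd B \<longrightarrow> k \<in> K \<longrightarrow> v x \<noteq> v k ^ n"
    and n: "2 \<le> n" "n dvd B" "k \<in> K" "v (1 / x) = v k ^ n"
  have "v x = v (1 / k) ^ n"
    using n(4) by (simp add: v_divide power_divide) (metis div_by_1 divide_divide_eq_right mult_1)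
  then show False
    using * n K_closed(2,7) by blast
qed

text \<open>A \<open>B\<close>-th power is an \<open>n\<close>-th power for every divisor
  \<open>n\<close> of \<open>B\<close>, so dividing by it cannot create or destroy roots.\<close>

lemma not_power_mult:
  assumes "not_power B x" "c \<in> K" "c \<noteq> 0"
  shows "not_power B (x / c ^ (B * j))"
  unfolding not_power_iff
proof (intro allI impI notI)
  fix n k assume n: "2 \<le> n" "n dvd B" "k \<in> K" "v (x / c ^ (B * j)) = v k ^ n"
  then obtain m where "B = n * m"
    by blast
  then have "v x = v (k * c ^ (m * j)) ^ n"
    using n(4) assms(3) by (simp add: v_divide v_mult v_power power_mult_distrib field_simps flip: power_mult)
  moreover have "k * c ^ (m * j) \<in> K"
    using n(3) assms(2) by (intro K_closed(6,8))
  ultimately show False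
    using assms(1) n unfolding not_power_iff by blast
qed

lemma power_sandwich:
  fixes t z :: real
  assumes "0 < t" "t < 1" "0 < z" "z < 1"
  obtains j where "t ^ Suc j < z" "z \<le> t ^ j"
proof -
  have ex: "\<exists>n. t ^ n < z"
    using real_arch_pow_inv[OF assms(3,2)] .
  define N where "N = (LEAST n. t ^ n < z)"
  have N: "t ^ N < z"
    unfolding N_def using LeastI_ex[OF ex] .
  then obtain j where j: "N = Suc j"
    using assms(4) by (cases N) auto
  have "\<not> t ^ j < z"
    using not_less_Least[of j "\<lambda>n. t ^ n < z"] j unfolding N_def by simp
  with N j show ?thesis
    by (intro that[of j]) auto
qed

text \<open>
  Either the value group has elements close enough to \<open>1\<close> to move \<open>v x\<close> by \<open>B\<close>-th powers into the
  range, or it is discrete, and then a generator will do.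
\<close>

lemma not_power_near_1:
  assumes x: "not_power B x" "x \<in> K" and B: "B \<ge> 2" and r: "r \<in> K" "v r < 1"
  obtains y where "y \<in> K" "not_power B y" "v r \<le> v y" "0 < v y" "v y < 1"
proof -
  define x' where "x' = (if v x < 1 then x else 1 / x)"
  have x': "not_power B x'" "x' \<in> K"
    using x not_power_inverse K_closed unfolding x'_def by auto
  have vx': "0 < v x'" "v x' < 1"
    using not_power_nontrivial[OF x(1) B] unfolding x'_def by (auto simp: v_divide)
  show ?thesis
  \<comment> \<open>In the application \<open>r\<close> is the image of \<open>p\<close> in
    \<open>K\<close>, which is 0 if \<open>p = 0\<close> or if \<open>K\<close> has characteristic
    \<open>p\<close>. Then there is no positive lower bound to meet.\<close>
  proof (cases "r = 0")
    case True
    then show ?thesis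
      using that[of x'] x' vx' by simp
  next
    case False
    \<comment> \<open>If \<open>v c\<close> lies in [\<tau>, 1), then \<open>v c ^ B\<close> is at
      least \<open>v r\<close>, so steps by powers of \<open>c ^ B\<close> cannot jump over the
      target range.\<close>
    define \<tau> where "\<tau> = root B (v r)"
    have \<tau>: "0 < \<tau>" "\<tau> < 1" "\<tau> ^ B = v r"
      using False r(2) B unfolding \<tau>_def by simp_all
    show ?thesis
    proof (cases "\<exists>c \<in> K. \<tau> \<le> v c \<and> v c < 1")
      case True
      then obtain c where c: "c \<in> K" "\<tau> \<le> v c" "v c < 1"
        by blast
      then have "c \<noteq> 0"
        using \<tau>(1) by auto
      have t: "0 < v c ^ B" "v c ^ B < 1" "v r \<le> v c ^ B"
        using c \<open>c \<noteq> 0\<close> \<tau> B power_mono[of \<tau> "v c" B] by (auto simp: power_less_one_iff)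
      obtain j where j: "(v c ^ B) ^ Suc j < v x'" "v x' \<le> (v c ^ B) ^ j"
        using power_sandwich[OF t(1,2) vx'] .
      \<comment> \<open>Its absolute value lies above \<open>v c ^ B\<close> and is at most 1; the
        value 1 is excluded because \<open>not_power\<close> is preserved.\<close>
      define y where "y = x' / c ^ (B * j)"
      have y: "not_power B y" "y \<in> K"
        unfolding y_def using not_power_mult[OF x'(1) c(1) \<open>c \<noteq> 0\<close>] x'(2) c(1) K_closed by auto
      have vy: "v y = v x' / (v c ^ B) ^ j"
        unfolding y_def by (simp add: v_divide v_power power_mult)
      have "(v c ^ B) ^ j > 0"
        using t(1) by simp
      then have "v c ^ B < v y" "v y \<le> 1"
        using j unfolding vy by (simp_all add: field_simps)
      then show ?thesis
        using that[of y] y t(1,3) not_power_nontrivial[OF y(1) B] by simp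
    next
      case gap: False
      \<comment> \<open>Without such a \<open>c\<close>, two values of \<open>K\<close> whose ratio
        lies in [\<tau>, 1) would have a quotient in the gap. So a value within the factor \<tau> of
        the supremum is already the largest value below 1.\<close>
      define S where "S = {z \<in> v ` K. v x' \<le> z \<and> z < 1}"
      have S: "S \<noteq> {}" "bdd_above S" "v x' \<in> S"
        unfolding S_def using x'(2) vx' by (auto intro!: bdd_aboveI[of _ 1])
      define s where "s = Sup S"
      have "s > 0"
        using cSup_upper[OF S(3,2)] vx' unfolding s_def by linarith
      then have "s * \<tau> < Sup S"
        using \<tau> unfolding s_def by simp
      then obtain z where "z \<in> S" "s * \<tau> < z"
        using less_cSup_iff[OF S(1,2)] by blast
      then obtain g where g: "g \<in> K" "v g < 1" "v x' \<le> v g" "s * \<tau> < v g"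
        unfolding S_def by blast
      have g_max: "v k \<le> v g" if "k \<in> K" "v k < 1" for k
      proof (rule ccontr)
        assume less: "\<not> v k \<le> v g"
        then have "v k \<in> S"
          using that g unfolding S_def by auto
        then have "v k \<le> s"
          unfolding s_def using S(2) by (rule cSup_upper)
        then have "v k * \<tau> \<le> v g"
          using g(4) \<tau>(1) mult_right_mono[of "v k" s \<tau>] by linarith
        moreover have "v k > 0"
          using less v_nonneg[of g] by linarith
        ultimately have "\<tau> \<le> v (g / k)" "v (g / k) < 1"
          using less by (simp_all add: v_divide field_simps)
        then show False
          using gap g(1) that(1) K_closed(7) by blast
      qed
      have "v g > 0"
        using g(3) vx'(1) by linarith
      obtain j where j: "v g ^ Suc j < v x'" "v x' \<le> v g ^ j"
        using power_sandwich[OF \<open>v g > 0\<close> g(2) vx'] .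
      \<comment> \<open>Otherwise the quotient would have absolute value strictly between
        \<open>v g\<close> and 1. Since \<open>v x'\<close> is thus a power of \<open>v g\<close>, a
        root of \<open>v g\<close> in the value group would give one of \<open>v x'\<close>.\<close>
      have "v x' = v g ^ j"
      proof (rule ccontr)
        assume "v x' \<noteq> v g ^ j"
        then have "v (x' / g ^ j) < 1"
          using j(2) \<open>v g > 0\<close> by (simp add: v_divide v_power)
        then have "v (x' / g ^ j) \<le> v g"
          using x'(2) g(1) by (intro g_max K_closed(7,8))
        then show False
          using j(1) \<open>v g > 0\<close> by (simp add: v_divide v_power field_simps)
      qed
      have "not_power B g"
        unfolding not_power_iff
      proof (intro allI impI notI)
        fix n k assume n: "2 \<le> n" "n dvd B" "k \<in> K" "v g = v k ^ n"
        then have "v x' = v (k ^ j) ^ n"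
          using \<open>v x' = v g ^ j\<close> by (simp add: v_power mult.commute flip: power_mult)
        then show False
          using x'(1) n K_closed(8) unfolding not_power_iff by blast
      qed
      then show ?thesis
        using that[of g] g \<open>v g > 0\<close> g_max[OF r] by blast
    qed
  qed
qed

end

section \<open>Residue characteristic and binomial coefficients\<close>

context valued_subfield
begin

lemma residue_char_dvd_iff: "residue_char v F dvd n \<longleftrightarrow> v (of_nat n) < 1"
proof -
  have mem: "of_nat n \<in> O\<^sub>F" for n
    using v_of_nat_le[of n] subfield_Kbar_closed(9)[OF subfield_F] by (simp add: val_ring_simps(1))
  have pow: "\<one>\<^bsub>k\<^sub>F\<^esub> [^]\<^bsub>add_monoid k\<^sub>F\<^esub> n = residue (of_nat n)" for n :: nat
  proof (induction n)
    case 0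
    then show ?case
      using red.hom_zero by (simp add: val_ring_simps(3))
  next
    case (Suc n)
    have "residue (of_nat n + 1) = residue (of_nat n) \<oplus>\<^bsub>k\<^sub>F\<^esub> \<one>\<^bsub>k\<^sub>F\<^esub>"
      using red.hom_add[OF mem[of n] val_ring_mem(2)] red.hom_one by (simp add: val_ring_simps(2,5))
    with Suc show ?case
      by (simp add: add.commute)
  qed
  have "residue_char v F dvd n \<longleftrightarrow> \<one>\<^bsub>k\<^sub>F\<^esub> [^]\<^bsub>add_monoid k\<^sub>F\<^esub> n = \<one>\<^bsub>add_monoid k\<^sub>F\<^esub>"
    unfolding residue_char_def using group.pow_eq_id[OF k.a_group, of "\<one>\<^bsub>k\<^sub>F\<^esub>" n] by simp
  then show ?thesis
    unfolding pow using residue_eq_0_iff[OF mem] by simp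
qed

lemma prime_residue_char:
  assumes "residue_char v F > 0"
  shows "prime (residue_char v F)"
  unfolding prime_elem_nat_iff[symmetric] prime_elem_def
proof (intro conjI allI impI)
  show "\<not> is_unit (residue_char v F)"
    using residue_char_dvd_iff[of 1] by simp
  fix x y assume "residue_char v F dvd x * y"
  then have "v (of_nat x) * v (of_nat y) < 1"
    unfolding residue_char_dvd_iff by (simp add: v_mult)
  then have "v (of_nat x) < 1 \<or> v (of_nat y) < 1"
    using v_of_nat_le[of x] v_of_nat_le[of y] by (metis linorder_not_less mult_1 antisym less_irrefl)
  then show "residue_char v F dvd x \<or> residue_char v F dvd y"
    unfolding residue_char_dvd_iff .
qed (use assms in simp)

end

text \<open>From \<open>k * (q choose k) = q * (q - 1 choose k - 1)\<close> with
  \<open>q = p ^ e\<close>: if \<open>p\<close> did not divide the binomial coefficient, all of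
  \<open>q\<close> would divide \<open>k\<close>.\<close>

lemma prime_dvd_prime_power_choose:
  fixes p :: nat
  assumes "prime p" "0 < k" "k < p ^ e"
  shows "p dvd p ^ e choose k"
proof (rule ccontr)
  assume "\<not> p dvd p ^ e choose k"
  then have "coprime (p ^ e) (p ^ e choose k)"
    using assms(1) by (simp add: prime_imp_coprime)
  moreover obtain k' where k': "k = Suc k'"
    using assms(2) by (cases k) auto
  moreover obtain q where q: "p ^ e = Suc q"
    using assms(3) by (cases "p ^ e") auto
  have "p ^ e dvd k * (p ^ e choose k)"
    using Suc_times_binomial_eq[of q k'] unfolding k' q by (metis dvd_triv_left mult.commute)
  ultimately have "p ^ e dvd k"
    using coprime_dvd_mult_left_iff by blast
  then show False
    using assms(2,3) nat_dvd_not_less by blast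
qed

section \<open>From a disk of good reduction to the degree bound\<close>

lemma poly_at_Fract_1: "poly_at f (Fract p 1) = Fract (pcompose f p) 1"
  by (induction f) (auto simp: pcompose_pCons Zero_fract_def)

text \<open>Conjugation by \<open>(z - a) / c\<close>. The entries \<open>- (- a)\<close> and
  \<open>- 0\<close> are left in the shape that \<open>conjugate_over\<close> produces.\<close>

lemma affine_conjugate:
  fixes P Q :: "'a::field poly"
  assumes "Q \<noteq> 0" "c \<noteq> 0"
  shows "ratfun_comp (ratfun_comp (mobius 1 (- a) 0 c) (Fract P Q)) (mobius c (- (- a)) (- 0) 1) =
    Fract (pcompose (P - smult a Q) [:a, c:]) (smult c (pcompose Q [:a, c:]))"
proof -
  have "ratfun_comp (mobius 1 (- a) 0 c) (Fract P Q) = Fract (P - smult a Q) (smult c Q)"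
    unfolding mobius_def using assms
    by (subst ratfun_comp_Fract) (auto simp: Zero_fract_def eq_fract algebra_simps smult_diff_right)
  moreover have "mobius c (- (- a)) (- 0) 1 = Fract [:a, c:] 1"
    by (simp add: mobius_def one_pCons)
  moreover have "pcompose Q [:a, c:] \<noteq> 0"
    using assms by (simp add: pcompose_eq_0_iff)
  ultimately show ?thesis
    using assms by (simp add: ratfun_comp_Fract poly_at_Fract_1 pcompose_smult Zero_fract_def eq_fract)
qed

text \<open>The common part of the three examples. The alternatives in \<open>y\<close> say where
  the element of order \<open>B\<close> is found: the radius itself for a disk around 0, or the
  ratio of radius and centre for a disk avoiding 0.\<close>

lemma potentially_good_example:
  fixes K :: "'a::alg_closed_field set" and v :: "'a \<Rightarrow> real"
  assumes cl: "algebraic_closure (Kbar :: 'a ring) K" and v: "nonarch_abs v"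
    and PQ: "P \<in> poly_over K" "Q \<in> poly_over K" "base_point_free d P Q" "d \<ge> 2"
    and c: "c \<noteq> 0"
    and good: "\<And>F. subfield F Kbar \<Longrightarrow> a \<in> F \<Longrightarrow> c \<in> F \<Longrightarrow> good_reduction v F
      (Fract (pcompose (P - smult a Q) [:a, c:]) (smult c (pcompose Q [:a, c:])))"
    and x: "x \<in> K" "x \<noteq> 0" "value_group.not_power v K B x"
    and y: "a = 0 \<and> v c ^ B = v x \<or> v c < v a \<and> v (c / a) ^ B = v x"
  shows "\<exists>\<phi> \<in> ratfun_over K. ratfun_degree \<phi> = d \<and> potentially_good_reduction v K \<phi> \<and>
           (\<forall>L. field_extension K L \<and> (\<exists>n<B. ring.dimension Kbar n K L) \<longrightarrow>
                \<not> (\<exists>\<psi>. conjugate_over L \<phi> \<psi> \<and> good_reduction v L \<psi>))"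
proof -
  have subfield_K: "subfield K Kbar"
    using cl by (simp add: algebraic_closure_def)
  interpret value_group v K
    by (intro value_group.intro nonarch_field.intro value_group_axioms.intro v subfield_K)
  have "d \<ge> 1"
    using PQ(4) by simp
  note bp = base_point_freeD[OF PQ(3) this]
  \<comment> \<open>\<open>F\<close> is \<open>K(a, c)\<close>, of finite degree because the ambient
    field is algebraic over \<open>K\<close>. It witnesses potentially good reduction.\<close>
  define F where "F = R.finite_extension K [a, c]"
  have alg: "(R.algebraic over K) z" for z
    using algebraic_closure.algebraic_extension[OF cl] by (simp add: Kbar_simps)
  have F: "subfield F Kbar" "R.finite_dimension K F"
    unfolding F_def using alg
    by (intro R.finite_extension_is_subfield R.finite_extension_finite_dimension(1) subfield_K;
        simp add: Kbar_simps)+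
  have KF: "K \<subseteq> F" "a \<in> F" "c \<in> F"
    using R.finite_extension_incl[of K "[a, c]"] R.finite_extension_mem[OF subfieldE(1)[OF subfield_K], of "[a, c]"]
    unfolding F_def by (auto simp: Kbar_simps)
  define \<psi> where "\<psi> = ratfun_comp (ratfun_comp (mobius 1 (- a) 0 c) (Fract P Q)) (mobius c (- (- a)) (- 0) 1)"
  have \<psi>: "good_reduction v F \<psi>"
    unfolding \<psi>_def affine_conjugate[OF bp(2) c] using good F(1) KF by blast
  have "conjugate_over F (Fract P Q) \<psi>"
    unfolding conjugate_over_def \<psi>_def
    using KF c subfield_Kbar_closed[OF F(1)]
    by (intro bexI[of _ 1] bexI[of _ "- a"] bexI[of _ 0] bexI[of _ c] conjI refl) auto
  then have pot: "potentially_good_reduction v K (Fract P Q)"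
    unfolding potentially_good_reduction_def field_extension_def using F KF(1) \<psi> by blast
  have lower: "B \<le> n" if L: "field_extension K L" "R.dimension n K L"
    "conjugate_over L (Fract P Q) \<chi>" "good_reduction v L \<chi>" for L n \<chi>
  proof -
    have L': "subfield L Kbar"
      using L(1) by (simp add: field_extension_def)
    obtain \<alpha> \<beta> \<gamma> \<delta> where mem: "\<alpha> \<in> L" "\<beta> \<in> L" "\<gamma> \<in> L" "\<delta> \<in> L" and det: "\<alpha> * \<delta> - \<beta> * \<gamma> \<noteq> 0"
      and \<chi>: "\<chi> = ratfun_comp (ratfun_comp (mobius \<alpha> \<beta> \<gamma> \<delta>) (Fract P Q)) (mobius \<delta> (- \<beta>) (- \<gamma>) \<alpha>)"
      using L(3) unfolding conjugate_over_def by blast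
    have det1: "1 * c - (- a) * 0 \<noteq> 0"
      using c by simp
    obtain s where s: "s > 0" "\<And>x y. max (v (\<alpha> * x + \<beta> * y)) (v (\<gamma> * x + \<delta> * y)) =
        s * max (v (1 * x + (- a) * y)) (v (0 * x + c * y))"
      using good_conjugates_proportional[OF v PQ(3,4) L' det L(4)[unfolded \<chi>] F(1) det1 \<psi>[unfolded \<psi>_def]]
      by blast
    obtain t u where tu: "t \<in> L" "u \<in> L" "v (a - t) \<le> v c" "v u = v c"
      using disk_defined_over[OF L' mem det s(1), of a c] s(2) by auto
    have "\<exists>w \<in> L. v w ^ B = v x"
      using y
    proof (elim disjE conjE)
      assume "v c ^ B = v x"
      with tu(2,4) show ?thesis
        by (intro bexI[of _ u]) simp_all
    next
      assume *: "v c < v a" "v (c / a) ^ B = v x"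
      \<comment> \<open>The disk avoids 0, so all its points have the same absolute value as
        \<open>a\<close>.\<close>
      have "v t = v a"
        using v_add_eq[of "t - a" a] tu(3) * v_minus[of "a - t"] by simp
      then have "v (u / t) ^ B = v x"
        using * tu(4) by (simp add: v_divide)
      then show ?thesis
        using tu subfield_Kbar_closed(7)[OF L'] by blast
    qed
    then obtain w where w: "w \<in> L" "v w ^ B = v x"
      by blast
    show ?thesis
    \<comment> \<open>As \<open>0 ^ 0 = 1\<close>, the equation for \<open>w\<close> admits
      \<open>w = 0\<close>, but only with \<open>B = 0\<close>.\<close>
    proof (cases "w = 0")
      case True
      then have "B = 0"
        using w(2) x(2) by (cases B) auto
      then show ?thesis
        by simp
    next
      case False
      show ?thesis
        by (rule dimension_ge[OF x(3,1) w(2) False L' w(1) L(2)])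
    qed
  qed
  have "Fract P Q \<in> ratfun_over K"
    unfolding ratfun_over_def using PQ(1,2) bp(2) by blast
  moreover have "ratfun_degree (Fract P Q) = d"
    using ratfun_degree_Fract[OF bp(2,3)] bp(4) by simp
  ultimately show ?thesis
    using pot lower by (intro bexI[of _ "Fract P Q"]) force+
qed

subsection \<open>The examples\<close>

lemma poly_over_closed:
  fixes F :: "'a::field set"
  assumes F: "subfield F Kbar"
  shows "0 \<in> poly_over F" "1 \<in> poly_over F"
    "f \<in> poly_over F \<Longrightarrow> g \<in> poly_over F \<Longrightarrow> f + g \<in> poly_over F"
    "f \<in> poly_over F \<Longrightarrow> g \<in> poly_over F \<Longrightarrow> f - g \<in> poly_over F"
    "f \<in> poly_over F \<Longrightarrow> g \<in> poly_over F \<Longrightarrow> f * g \<in> poly_over F"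
    "f \<in> poly_over F \<Longrightarrow> f ^ n \<in> poly_over F"
    "x \<in> F \<Longrightarrow> f \<in> poly_over F \<Longrightarrow> pCons x f \<in> poly_over F"
    "x \<in> F \<Longrightarrow> f \<in> poly_over F \<Longrightarrow> smult x f \<in> poly_over F"
proof -
  note cl = subfield_Kbar_closed[OF F]
  have sum: "sum h A \<in> F" if "\<And>i. i \<in> A \<Longrightarrow> h i \<in> F" for h :: "nat \<Rightarrow> 'a" and A
    using that by (induction A rule: infinite_finite_induct) (simp_all add: cl)
  show "0 \<in> poly_over F" and one: "1 \<in> poly_over F"
    by (simp_all add: poly_over_def coeff_1 cl)
  show "f \<in> poly_over F \<Longrightarrow> g \<in> poly_over F \<Longrightarrow> f + g \<in> poly_over F"
    "f \<in> poly_over F \<Longrightarrow> g \<in> poly_over F \<Longrightarrow> f - g \<in> poly_over F"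
    "x \<in> F \<Longrightarrow> f \<in> poly_over F \<Longrightarrow> smult x f \<in> poly_over F"
    by (simp_all add: poly_over_def cl)
  show "x \<in> F \<Longrightarrow> f \<in> poly_over F \<Longrightarrow> pCons x f \<in> poly_over F"
    by (simp add: poly_over_def coeff_pCons split: nat.split)
  show mult: "f \<in> poly_over F \<Longrightarrow> g \<in> poly_over F \<Longrightarrow> f * g \<in> poly_over F" for f g
    by (simp add: poly_over_def coeff_mult sum cl)
  show "f \<in> poly_over F \<Longrightarrow> f ^ n \<in> poly_over F"
    by (induction n) (simp_all add: one mult)
qed

lemma pcompose_power: "pcompose (f ^ n) g = pcompose f g ^ n"
  for f g :: "'a::field poly"
  by (induction n) (simp_all add: pcompose_mult one_pCons pcompose_pCons)

lemma monic_power: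
  fixes f :: "'a::field poly"
  assumes "degree f \<le> n" "coeff f n = 1"
  shows "degree (f ^ m) \<le> n * m" "coeff (f ^ m) (n * m) = 1"
proof -
  have "degree (f ^ m) \<le> n * m \<and> coeff (f ^ m) (n * m) = 1"
  proof (induction m)
    case (Suc m)
    then have "degree (f ^ Suc m) \<le> n + n * m"
      using assms(1) by (metis add_mono degree_mult_le order_trans power_Suc)
    with Suc show ?case
      using coeff_mult_bounded[OF assms(1), of "f ^ m" "n * m"] assms(2) by simp
  qed simp
  then show "degree (f ^ m) \<le> n * m" "coeff (f ^ m) (n * m) = 1"
    by blast+
qed

text \<open>
  \<open>disk_poly q a c\<close> is \<open>z ^ q - a ^ q\<close> in the coordinate \<open>z = a + c w\<close>, divided by \<open>c ^ q\<close>.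
  If \<open>q\<close> is a power of \<open>p\<close>, its middle coefficients are divisible by \<open>p\<close>, so they remain integral
  if \<open>v c\<close> is slightly smaller than \<open>v a\<close>.
\<close>

definition disk_poly :: "nat \<Rightarrow> 'a::field \<Rightarrow> 'a \<Rightarrow> 'a poly" where
  "disk_poly q a c = [:a / c, 1:] ^ q - [:(a / c) ^ q:]"

lemma pcompose_disk_poly:
  fixes a c :: "'a::field"
  assumes "c \<noteq> 0"
  shows "pcompose ([:0, 1:] ^ q - [:a ^ q:]) [:a, c:] = smult (c ^ q) (disk_poly q a c)"
proof -
  have "[:a, c:] ^ q = smult (c ^ q) ([:a / c, 1:] ^ q)"
    using assms by (simp flip: smult_power)
  moreover have "[:a ^ q:] = smult (c ^ q) [:(a / c) ^ q:]"
    using assms by (simp add: power_divide)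
  ultimately show ?thesis
    by (simp add: disk_poly_def pcompose_diff pcompose_power pcompose_pCons smult_diff_right)
qed

lemma disk_poly_monic:
  fixes a c :: "'a::field"
  assumes "q > 0"
  shows "degree (disk_poly q a c) \<le> q" "coeff (disk_poly q a c) q = 1"
proof -
  have "degree ([:a / c, 1:] ^ q) \<le> q" "coeff ([:a / c, 1:] ^ q) q = 1"
    using monic_power[of "[:a / c, 1:]" 1 q] by simp_all
  then show "degree (disk_poly q a c) \<le> q" "coeff (disk_poly q a c) q = 1"
    using assms unfolding disk_poly_def
    by (auto intro!: degree_diff_le simp: coeff_pCons split: nat.split)
qed

lemma (in valued_subfield) disk_poly_integral:
  assumes ac: "a \<in> F" "c \<in> F" "c \<noteq> 0" "v c \<le> v a" and p: "prime p"
    and pv: "v (of_nat p) * v (a / c) ^ (p ^ e) \<le> 1"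
  shows "disk_poly (p ^ e) a c \<in> poly_over O\<^sub>F"
  unfolding poly_over_val_ring
proof
  note cl = subfield_Kbar_closed[OF subfield_F] poly_over_closed[OF subfield_F]
  show "disk_poly (p ^ e) a c \<in> poly_over F"
    unfolding disk_poly_def using ac by (simp add: cl)
  have q: "p ^ e > 0"
    using p by (simp add: prime_gt_0_nat)
  have ge_1: "1 \<le> v (a / c)"
    using ac by (simp add: v_divide)
  show "integral_poly (disk_poly (p ^ e) a c)"
    unfolding integral_poly_def
  proof
    fix i
    consider "i = 0" | "0 < i" "i < p ^ e" | "i = p ^ e" | "i > p ^ e"
      by linarith
    then show "v (coeff (disk_poly (p ^ e) a c) i) \<le> 1"
    proof cases
      \<comment> \<open>Subtracting \<open>a ^ q\<close> serves to kill the constant term, which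
        carries no factor \<open>p\<close>.\<close>
      case 1
      then show ?thesis
        by (simp add: disk_poly_def coeff_0_power)
    next
      case 2
      obtain l where l: "p ^ e choose i = p * l"
        using prime_dvd_prime_power_choose[OF p 2] by blast
      have "coeff (disk_poly (p ^ e) a c) i = of_nat (p ^ e choose i) * (a / c) ^ (p ^ e - i)"
        using 2 coeff_linear_poly_power[of i "p ^ e" "a / c" 1]
        by (simp add: disk_poly_def coeff_pCons split: nat.split)
      then have "v (coeff (disk_poly (p ^ e) a c) i) = v (of_nat l) * (v (of_nat p) * v (a / c) ^ (p ^ e - i))"
        by (simp add: l v_mult v_power)
      also have "\<dots> \<le> 1 * (v (of_nat p) * v (a / c) ^ (p ^ e))"
        using ge_1 v_of_nat_le[of l] by (intro mult_mono power_increasing) auto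
      also have "\<dots> \<le> 1"
        using pv by simp
      finally show ?thesis .
    next
      case 3
      then show ?thesis
        using disk_poly_monic(2)[OF q, of a c] by simp
    next
      case 4
      then show ?thesis
        using disk_poly_monic(1)[OF q, of a c] by (simp add: coeff_eq_0)
    qed
  qed
qed

text \<open>The exponents of \<open>x\<close> in \<open>c ^ (q D)\<close> and
  \<open>a ^ (q D)\<close> are \<open>q j\<close> and \<open>D i\<close>, which differ by 1. The
  last bound follows from \<open>v x = v (c / a) ^ (q D) <= v (c / a) ^ q\<close>.\<close>

lemma (in nonarch_field) wild_disk:
  fixes x :: 'a
  assumes q: "coprime q D" "q > 0" "D > 0" and D: "D \<ge> 2" and x: "0 < v x" "v x < 1" and r: "r \<le> v x"
    and ac: "a ^ q = x ^ i" "c ^ D = x ^ j" "q * j = D * i + 1"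
  shows "a \<noteq> 0" "c \<noteq> 0" "v (c / a) ^ (q * D) = v x" "v c < v a" "r * v (a / c) ^ q \<le> 1"
proof -
  have "x \<noteq> 0"
    using x(1) by simp
  then show nz: "a \<noteq> 0" "c \<noteq> 0"
    using ac(1,2) q by (metis power_eq_0_iff)+
  have "(c / a) ^ (q * D) = (c ^ D) ^ q / (a ^ q) ^ D"
    by (simp add: power_divide mult.commute flip: power_mult)
  also have "(c ^ D) ^ q = x ^ (D * i + 1)"
    by (metis ac(2,3) mult.commute power_mult)
  also have "(a ^ q) ^ D = x ^ (D * i)"
    by (metis ac(1) mult.commute power_mult)
  also have "x ^ (D * i + 1) / x ^ (D * i) = x"
    using \<open>x \<noteq> 0\<close> by simp
  finally have eq: "v (c / a) ^ (q * D) = v x"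
    by (metis v_power)
  then show "v (c / a) ^ (q * D) = v x" .
  have "\<not> 1 \<le> v (c / a)"
    using one_le_power[of "v (c / a)" "q * D"] eq x(2) by linarith
  then have less: "v (c / a) < 1"
    by simp
  then show "v c < v a"
    using nz by (simp add: v_divide)
  have "v x \<le> v (c / a) ^ q"
    unfolding eq[symmetric] using less q by (intro power_decreasing) auto
  then have "r \<le> v (c / a) ^ q"
    using r by linarith
  moreover have "v (c / a) ^ q * v (a / c) ^ q = 1"
    using nz by (simp add: v_divide flip: power_mult_distrib)
  ultimately show "r * v (a / c) ^ q \<le> 1"
    using mult_right_mono[of r "v (c / a) ^ q" "v (a / c) ^ q"] by simp
qed

text \<open>Here \<open>D = d - 1\<close>, which is coprime to \<open>q\<close> because
  \<open>q\<close> divides \<open>d\<close>. The map is a polynomial, so the Bezout identity is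
  trivial and good reduction rests on the integrality of \<open>W\<close> and its leading
  coefficient 1.\<close>

lemma wild_example_1:
  fixes K :: "'a::alg_closed_field set" and v :: "'a \<Rightarrow> real"
  assumes cl: "algebraic_closure (Kbar :: 'a ring) K" and v: "nonarch_abs v"
    and d: "d \<ge> 3" "d = m * q" and q: "q = p ^ e" "q > 1" and p: "prime p"
    and x: "x \<in> K" "value_group.not_power v K (q * (d - 1)) x" "0 < v x" "v x < 1" "v (of_nat p) \<le> v x"
  shows "\<exists>\<phi> \<in> ratfun_over K. ratfun_degree \<phi> = d \<and> potentially_good_reduction v K \<phi> \<and>
           (\<forall>L. field_extension K L \<and> (\<exists>n<q * (d - 1). ring.dimension Kbar n K L) \<longrightarrow>
                \<not> (\<exists>\<psi>. conjugate_over L \<phi> \<psi> \<and> good_reduction v L \<psi>))"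
proof -
  have K: "subfield K Kbar"
    using cl by (simp add: algebraic_closure_def)
  interpret nonarch_field v
    using v by (rule nonarch_field.intro)
  have "coprime q (d - 1)"
  proof -
    have "coprime d (d - 1)"
      using d(1) coprime_diff_one_left_nat[of d] by (simp add: coprime_commute)
    then show ?thesis
      using d(2) by simp
  qed
  then obtain j i where ij: "q * j = (d - 1) * i + 1"
    using bezout_nat[of q "d - 1"] q(2) by (metis coprime_imp_gcd_eq_1 not_less_zero)
  obtain a where a: "a ^ q = x ^ i"
    using nth_root_exists[of q "x ^ i"] q(2) by auto
  obtain c where c: "c ^ (d - 1) = x ^ j"
    using nth_root_exists[of "d - 1" "x ^ j"] d(1) by auto
  note disk = wild_disk[OF \<open>coprime q (d - 1)\<close> _ _ _ x(3,4,5) a c ij]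
  have ac: "c \<noteq> 0" "v (c / a) ^ (q * (d - 1)) = v x" "v c < v a" "v (of_nat p) * v (a / c) ^ q \<le> 1"
    using disk d(1) q(2) by auto
  \<comment> \<open>Chosen so that \<open>A * c ^ (d - 1) = 1\<close>.\<close>
  define A where "A = 1 / x ^ j"
  define R where "R = [:0, 1:] ^ q - [:a ^ q:]"
  define P where "P = [:0, 1:] + smult A (R ^ m)"
  define W where "W = disk_poly q a c"
  note closed = subfield_Kbar_closed[OF K] poly_over_closed[OF K]
  have "x ^ j \<noteq> 0"
    using x(3) by simp
  have P: "P \<in> poly_over K"
    unfolding P_def R_def A_def a using x(1) by (simp add: closed)
  have "degree R \<le> q" "coeff R q = 1"
    using monic_power[of "[:0, 1 :: 'a:]" 1 q] q(2) unfolding R_def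
    by (auto intro!: degree_diff_le simp: coeff_pCons split: nat.split)
  from monic_power[OF this, of m] have Rm: "degree (R ^ m) \<le> d" "coeff (R ^ m) d = 1"
    by (simp_all add: d(2) mult.commute)
  have deg_P: "degree P \<le> d" "coeff P d \<noteq> 0"
    using Rm d(1) \<open>x ^ j \<noteq> 0\<close> unfolding P_def A_def
    by (auto intro!: degree_add_le order_trans[OF degree_smult_le] simp: coeff_pCons split: nat.split)
  then have "degree P = d"
    using le_degree[of P d] by simp
  then have bp: "base_point_free d P 1"
    by (intro coprime_imp_base_point_free) auto
  have pc: "pcompose (P - smult a 1) [:a, c:] = smult c ([:0, 1:] + W ^ m)"
  proof -
    have "A * c ^ (q * m) = c"
    proof -
      have "q * m = Suc (d - 1)"
        using d by (simp add: mult.commute)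
      then have "c ^ (q * m) = c * x ^ j"
        using c by simp
      then show ?thesis
        using \<open>x ^ j \<noteq> 0\<close> by (simp add: A_def)
    qed
    moreover have "smult A (pcompose (R ^ m) [:a, c:]) = smult (A * c ^ (q * m)) (W ^ m)"
      unfolding pcompose_power R_def W_def pcompose_disk_poly[OF ac(1)]
      by (simp add: smult_power power_mult)
    moreover have "pcompose (P - smult a 1) [:a, c:] = [:a, c:] + smult A (pcompose (R ^ m) [:a, c:]) - [:a:]"
      by (simp add: P_def pcompose_diff pcompose_add pcompose_smult pcompose_pCons)
    moreover have "[:a, c:] + S - [:a:] = [:0, c:] + S" for S
    proof -
      have "[:a, c:] - [:a:] = [:0, c:]"
        by simp
      then show ?thesis
        by (metis add.commute add_diff_eq)
    qed
    ultimately show ?thesis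
      by (simp add: smult_add_right)
  qed
  have good: "good_reduction v F (Fract (pcompose (P - smult a 1) [:a, c:]) (smult c (pcompose 1 [:a, c:])))"
    if F: "subfield F Kbar" "a \<in> F" "c \<in> F" for F
  proof -
    interpret F: valued_subfield v F
      by (intro valued_subfield.intro nonarch_field.intro valued_subfield_axioms.intro v F)
    have W: "W \<in> poly_over F.O\<^sub>F"
      unfolding W_def q(1) using F(2,3) ac p q(1) by (intro F.disk_poly_integral) auto
    have "degree W \<le> q" "coeff W q = 1"
      unfolding W_def using disk_poly_monic[of q a c] q(2) by simp_all
    from monic_power[OF this, of m] have Wm: "degree (W ^ m) \<le> d" "coeff (W ^ m) d = 1"
      by (simp_all add: d(2) mult.commute)
    have f: "[:0, 1:] + W ^ m \<in> poly_over F.O\<^sub>F"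
      using W poly_over_closed[OF F(1)] subfield_Kbar_closed[OF F(1)] unfolding F.poly_over_val_ring
      by (auto intro!: integral_poly_add integral_poly_power)
    have "good_reduction v F (Fract ([:0, 1:] + W ^ m) 1)"
    proof (rule F.good_reduction_Fract[OF f])
      show "degree ([:0, 1:] + W ^ m) \<le> d"
        using Wm(1) d(1) by (auto intro!: degree_add_le)
      show "v (coeff ([:0, 1:] + W ^ m) d) = 1 \<or> v (coeff 1 d) = 1"
        using Wm(2) d(1) by (auto simp: coeff_pCons split: nat.split)
      show "0 * ([:0, 1:] + W ^ m) + 1 * 1 = 1"
        by simp
    qed (auto intro: F.poly_over_0_1)
    moreover have "Fract (smult c ([:0, 1:] + W ^ m)) (smult c 1) = Fract ([:0, 1:] + W ^ m) 1"
      using ac(1) by (simp add: eq_fract)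
    ultimately show ?thesis
      unfolding pc by (simp add: one_pCons pcompose_pCons)
  qed
  have "x \<noteq> 0" "d \<ge> 2"
    using x(3) d(1) by auto
  then show ?thesis
    using potentially_good_example[OF cl v P _ bp _ ac(1) good x(1) _ x(2)] ac closed by blast
qed

text \<open>Here \<open>D = d\<close>, which is coprime to \<open>q\<close> because
  \<open>d = 1 + m q\<close>. The numerator constant \<open>x ^ j = c ^ d\<close> normalizes the
  conjugate to \<open>w + 1 / W ^ m\<close>, and \<open>(w * W ^ m + 1) - w * W ^ m = 1\<close> is
  the Bezout identity.\<close>

lemma wild_example_2:
  fixes K :: "'a::alg_closed_field set" and v :: "'a \<Rightarrow> real"
  assumes cl: "algebraic_closure (Kbar :: 'a ring) K" and v: "nonarch_abs v"
    and d: "d \<ge> 3" "d = 1 + m * q" and q: "q = p ^ e" "q > 1" and p: "prime p"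
    and x: "x \<in> K" "value_group.not_power v K (d * q) x" "0 < v x" "v x < 1" "v (of_nat p) \<le> v x"
  shows "\<exists>\<phi> \<in> ratfun_over K. ratfun_degree \<phi> = d \<and> potentially_good_reduction v K \<phi> \<and>
           (\<forall>L. field_extension K L \<and> (\<exists>n<d * q. ring.dimension Kbar n K L) \<longrightarrow>
                \<not> (\<exists>\<psi>. conjugate_over L \<phi> \<psi> \<and> good_reduction v L \<psi>))"
proof -
  have K: "subfield K Kbar"
    using cl by (simp add: algebraic_closure_def)
  interpret nonarch_field v
    using v by (rule nonarch_field.intro)
  have "coprime q d"
    unfolding d(2) by (metis add.commute coprime_iff_gcd_eq_1 gcd_1_nat gcd_add_mult gcd.commute)
  then obtain j i where ij: "q * j = d * i + 1"
    using bezout_nat[of q d] q(2) by (metis coprime_imp_gcd_eq_1 not_less_zero)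
  obtain a where a: "a ^ q = x ^ i"
    using nth_root_exists[of q "x ^ i"] q(2) by auto
  obtain c where c: "c ^ d = x ^ j"
    using nth_root_exists[of d "x ^ j"] d(1) by auto
  note disk = wild_disk[OF \<open>coprime q d\<close> _ _ _ x(3,4,5) a c ij]
  have ac: "c \<noteq> 0" "v (c / a) ^ (d * q) = v x" "v c < v a" "v (of_nat p) * v (a / c) ^ q \<le> 1"
    using disk d(1) q(2) by (auto simp: mult.commute)
  define R where "R = [:0, 1:] ^ q - [:a ^ q:]"
  define Q where "Q = R ^ m"
  define P where "P = [:0, 1:] * Q + [:x ^ j:]"
  define W where "W = disk_poly q a c"
  note closed = subfield_Kbar_closed[OF K] poly_over_closed[OF K]
  have "x ^ j \<noteq> 0"
    using x(3) by simp
  have PQ: "P \<in> poly_over K" "Q \<in> poly_over K"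
    unfolding P_def Q_def R_def a using x(1) by (simp_all add: closed del: mult_pCons_left)
  have "degree R \<le> q" "coeff R q = 1"
    using monic_power[of "[:0, 1 :: 'a:]" 1 q] q(2) unfolding R_def
    by (auto intro!: degree_diff_le simp: coeff_pCons split: nat.split)
  from monic_power[OF this, of m] have Qm: "degree Q \<le> m * q" "coeff Q (m * q) = 1"
    by (simp_all add: Q_def mult.commute)
  then have "Q \<noteq> 0"
    by auto
  have "degree P \<le> d" "coeff P d = 1"
    using Qm d degree_pCons_le[of 0 Q] unfolding P_def
    by (auto intro!: degree_add_le order_trans[OF degree_pCons_le] simp: coeff_pCons split: nat.split)
  then have "degree P = d"
    using le_degree[of P d] by simp
  moreover have "coprime P Q"
  proof (rule coprimeI)
    fix h assume "h dvd P" "h dvd Q"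
    then have "h dvd P - [:0, 1:] * Q"
      by (blast intro: dvd_diff dvd_mult)
    then have "h dvd [:x ^ j:]"
      by (simp add: P_def)
    moreover have "is_unit [:x ^ j:]"
      using \<open>x ^ j \<noteq> 0\<close> by (simp add: is_unit_const_poly_iff dvd_field_iff)
    ultimately show "is_unit h"
      by (rule dvd_trans)
  qed
  ultimately have bp: "base_point_free d P Q"
    using Qm(1) d(2) \<open>Q \<noteq> 0\<close> by (intro coprime_imp_base_point_free) auto
  have Qc: "pcompose Q [:a, c:] = smult (c ^ (q * m)) (W ^ m)"
    unfolding Q_def pcompose_power R_def W_def pcompose_disk_poly[OF ac(1)]
    by (simp add: smult_power power_mult)
  have cd: "c * c ^ (q * m) = x ^ j"
    using c by (simp add: d(2) mult.commute)
  have Pc: "pcompose (P - smult a Q) [:a, c:] = smult (x ^ j) ([:0, 1:] * W ^ m + 1)"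
  proof -
    have "pcompose (P - smult a Q) [:a, c:] = [:0, c:] * pcompose Q [:a, c:] + [:x ^ j:]"
      by (simp add: P_def pcompose_diff pcompose_add pcompose_mult pcompose_smult pcompose_pCons algebra_simps
          smult_add_left[symmetric])
    also have "[:0, c:] * pcompose Q [:a, c:] = smult (c * c ^ (q * m)) ([:0, 1:] * W ^ m)"
      unfolding Qc by (simp add: mult.commute)
    finally show ?thesis
      unfolding cd by (simp add: smult_add_right)
  qed
  have good: "good_reduction v F (Fract (pcompose (P - smult a Q) [:a, c:]) (smult c (pcompose Q [:a, c:])))"
    if F: "subfield F Kbar" "a \<in> F" "c \<in> F" for F
  proof -
    interpret F: valued_subfield v F
      by (intro valued_subfield.intro nonarch_field.intro valued_subfield_axioms.intro v F)
    have W: "W \<in> poly_over F.O\<^sub>F"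
      unfolding W_def q(1) using F(2,3) ac p q(1) by (intro F.disk_poly_integral) auto
    have "degree W \<le> q" "coeff W q = 1"
      unfolding W_def using disk_poly_monic[of q a c] q(2) by simp_all
    from monic_power[OF this, of m] have Wm: "degree (W ^ m) \<le> m * q" "coeff (W ^ m) (m * q) = 1"
      by (simp_all add: mult.commute)
    have X: "[:0, 1:] \<in> poly_over F.O\<^sub>F" and Wm_O: "W ^ m \<in> poly_over F.O\<^sub>F"
      using W poly_over_closed[OF F(1)] subfield_Kbar_closed[OF F(1)] unfolding F.poly_over_val_ring
      by (auto intro!: integral_poly_power)
    have f: "[:0, 1:] * W ^ m + 1 \<in> poly_over F.O\<^sub>F"
      by (intro F.poly_over_add F.poly_over_mult F.poly_over_0_1 X Wm_O)
    have neg: "- [:0, 1:] \<in> poly_over F.O\<^sub>F"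
      using X subfield_Kbar_closed[OF F(1)] poly_over_closed[OF F(1)] unfolding F.poly_over_val_ring
      by auto
    have "W ^ m \<noteq> 0"
      using Wm(2) by (metis coeff_0 zero_neq_one)
    have "good_reduction v F (Fract ([:0, 1:] * W ^ m + 1) (W ^ m))"
    proof (rule F.good_reduction_Fract[OF f Wm_O \<open>W ^ m \<noteq> 0\<close>])
      show "degree ([:0, 1:] * W ^ m + 1) \<le> d"
        using Wm(1) d(2) by (auto intro!: degree_add_le order_trans[OF degree_pCons_le])
      show "degree (W ^ m) \<le> d"
        using Wm(1) d(2) by simp
      show "v (coeff ([:0, 1:] * W ^ m + 1) d) = 1 \<or> v (coeff (W ^ m) d) = 1"
        using Wm(2) d by (auto simp: coeff_pCons coeff_1 split: nat.split)
      show "1 * ([:0, 1:] * W ^ m + 1) + (- [:0, 1:]) * W ^ m = 1"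
        by (simp add: algebra_simps)
    qed (intro F.poly_over_0_1 neg)+
    moreover have "Fract (smult (x ^ j) ([:0, 1:] * W ^ m + 1)) (smult (x ^ j) (W ^ m)) =
        Fract ([:0, 1:] * W ^ m + 1) (W ^ m)"
      using \<open>x ^ j \<noteq> 0\<close> \<open>W ^ m \<noteq> 0\<close> by (simp add: eq_fract)
    ultimately show ?thesis
      unfolding Pc Qc smult_smult cd by simp
  qed
  have "x \<noteq> 0" "d \<ge> 2"
    using x(3) d(1) by auto
  then show ?thesis
    using potentially_good_example[OF cl v PQ bp _ ac(1) good x(1) _ x(2)] ac by blast
qed

text \<open>Putting \<open>z = c w\<close> with \<open>c ^ (d + 1) = x\<close> turns
  \<open>x / z ^ d\<close> into \<open>1 / w ^ d\<close>. For \<open>d = p = 2\<close> the first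
  formula in \<open>B\<close> would give only 2, less than \<open>d + 1\<close>; hence its condition
  \<open>d >= 3\<close>.\<close>

lemma tame_example:
  fixes K :: "'a::alg_closed_field set" and v :: "'a \<Rightarrow> real"
  assumes cl: "algebraic_closure (Kbar :: 'a ring) K" and v: "nonarch_abs v" and d: "d \<ge> 2"
    and x: "x \<in> K" "value_group.not_power v K (d + 1) x" "x \<noteq> 0"
  shows "\<exists>\<phi> \<in> ratfun_over K. ratfun_degree \<phi> = d \<and> potentially_good_reduction v K \<phi> \<and>
           (\<forall>L. field_extension K L \<and> (\<exists>n<d + 1. ring.dimension Kbar n K L) \<longrightarrow>
                \<not> (\<exists>\<psi>. conjugate_over L \<phi> \<psi> \<and> good_reduction v L \<psi>))"
proof -
  have K: "subfield K Kbar"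
    using cl by (simp add: algebraic_closure_def)
  interpret nonarch_field v
    using v by (rule nonarch_field.intro)
  obtain c where c: "c ^ (d + 1) = x"
    using nth_root_exists[of "d + 1" x] by auto
  then have "c \<noteq> 0"
    using x(3) by auto
  define Q where "Q = [:0, 1 :: 'a:] ^ d"
  note closed = subfield_Kbar_closed[OF K] poly_over_closed[OF K]
  have PQ: "[:x:] \<in> poly_over K" "Q \<in> poly_over K"
    unfolding Q_def using x(1) by (simp_all add: closed)
  have "degree Q \<le> d" "coeff Q d = 1"
    using monic_power[of "[:0, 1 :: 'a:]" 1 d] unfolding Q_def by simp_all
  then have "degree Q = d" "Q \<noteq> 0"
    using le_degree[of Q d] by auto
  moreover have "coprime [:x:] Q"
    using x(3) by (intro is_unit_left_imp_coprime) (simp add: is_unit_const_poly_iff dvd_field_iff)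
  ultimately have bp: "base_point_free d [:x:] Q"
    by (intro coprime_imp_base_point_free) auto
  have Qc: "smult c (pcompose Q [:0, c:]) = smult x Q"
  proof -
    have "[:0, c:] ^ d = smult (c ^ d) Q"
      unfolding Q_def by (simp flip: smult_power)
    then show ?thesis
      using c by (simp add: Q_def pcompose_power pcompose_pCons)
  qed
  have good: "good_reduction v F (Fract (pcompose ([:x:] - smult 0 Q) [:0, c:]) (smult c (pcompose Q [:0, c:])))"
    if F: "subfield F Kbar" "0 \<in> F" "c \<in> F" for F
  proof -
    interpret F: valued_subfield v F
      by (intro valued_subfield.intro nonarch_field.intro valued_subfield_axioms.intro v F)
    have Q_O: "Q \<in> poly_over F.O\<^sub>F"
      using poly_over_closed[OF F(1)] subfield_Kbar_closed[OF F(1)] unfolding F.poly_over_val_ring Q_def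
      by (auto intro!: integral_poly_power)
    have "good_reduction v F (Fract 1 Q)"
      using \<open>degree Q = d\<close> \<open>coeff Q d = 1\<close>
      by (intro F.good_reduction_Fract[OF F.poly_over_0_1(2) Q_O \<open>Q \<noteq> 0\<close>, of d 1 0]) (auto intro: F.poly_over_0_1)
    moreover have "Fract [:x:] (smult x Q) = Fract 1 Q"
      using x(3) \<open>Q \<noteq> 0\<close> by (simp add: eq_fract)
    ultimately show ?thesis
      unfolding Qc by simp
  qed
  have "v c ^ (d + 1) = v x"
    using c v_power by metis
  then show ?thesis
    using potentially_good_example[OF cl v PQ bp d \<open>c \<noteq> 0\<close> good x(1,3,2)] by blast
qed

theorem theoremB:
  fixes K :: "'a::alg_closed_field set"
    and v :: "'a \<Rightarrow> real"
    and d :: nat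
    and \<pi> :: 'a
  defines "B \<equiv> bound_B (residue_char v K) d"
  assumes "algebraic_closure (Kbar :: 'a ring) K"
    and "nonarch_abs v"
    and "d \<ge> 2"
    and "\<pi> \<in> K"
    and "\<And>n. n \<ge> 2 \<Longrightarrow> n dvd B \<Longrightarrow> root n (v \<pi>) \<notin> v ` K"
  shows "\<exists>\<phi> \<in> ratfun_over K. ratfun_degree \<phi> = d \<and> potentially_good_reduction v K \<phi> \<and>
           (\<forall>L. field_extension K L \<and> (\<exists>n<B. ring.dimension Kbar n K L) \<longrightarrow>
                \<not> (\<exists>\<psi>. conjugate_over L \<phi> \<psi> \<and> good_reduction v L \<psi>))"
proof -
  have K: "subfield K Kbar"
    using assms(2) by (simp add: algebraic_closure_def)
  interpret V: valued_subfield v K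
    by (intro valued_subfield.intro nonarch_field.intro valued_subfield_axioms.intro assms(3) K)
  interpret G: value_group v K
    by (intro value_group.intro nonarch_field.intro value_group_axioms.intro assms(3) K)
  define p where "p = residue_char v K"
  have \<pi>: "G.not_power B \<pi>"
    unfolding G.not_power_def using assms(6) by blast
  \<comment> \<open>\<open>p = 0\<close> is excluded because it would make \<open>d\<close> equal to
    0 or 1.\<close>
  have wild: "prime p \<and> 1 < p ^ e"
    if "d \<ge> 3" "e \<ge> 1" "d = m * p ^ e \<or> d = 1 + m * p ^ e" for m e
  proof -
    have "p \<noteq> 0"
      using that by (cases "p = 0") (auto simp: power_0_left)
    then have "prime p"
      using V.prime_residue_char unfolding p_def by simp
    then show ?thesis
      using that(2) one_less_power[OF prime_gt_1_nat] by simp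
  qed
  \<comment> \<open>This replaces \<pi> by an element close enough to absolute value 1 for
    \<open>disk_poly\<close> to be integral.\<close>
  have adjust: "\<exists>x \<in> K. G.not_power B x \<and> v (of_nat p) \<le> v x \<and> 0 < v x \<and> v x < 1" if "B \<ge> 2"
  proof -
    have "v (of_nat p) < 1"
      using V.residue_char_dvd_iff[of p] unfolding p_def by simp
    then show ?thesis
      using G.not_power_near_1[OF \<pi> assms(5) that G.K_closed(9)] by metis
  qed
  consider (wild1) e m where "d \<ge> 3" "e \<ge> 1" "m \<ge> 1" "\<not> p dvd m" "d = m * p ^ e"
    | (wild2) e m where "d \<ge> 3" "e \<ge> 1" "m \<ge> 1" "\<not> p dvd m" "d = 1 + m * p ^ e"
    | (tame) "B = d + 1"
    unfolding B_def p_def bound_B_def by metis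
  then show ?thesis
  proof cases
    case wild1
    then have B: "B = p ^ e * (d - 1)"
      unfolding B_def p_def[symmetric] by (intro bound_B_1)
    have "prime p" "1 < p ^ e"
      using wild wild1 by blast+
    moreover have "2 * 1 \<le> p ^ e * (d - 1)"
      using \<open>1 < p ^ e\<close> wild1(1) by (intro mult_mono) auto
    ultimately show ?thesis
      using adjust wild_example_1[OF assms(2,3) wild1(1,5) refl] unfolding B by auto
  next
    case wild2
    then have B: "B = d * p ^ e"
      unfolding B_def p_def[symmetric] by (intro bound_B_2)
    have "prime p" "1 < p ^ e"
      using wild wild2 by blast+
    moreover have "2 * 1 \<le> d * p ^ e"
      using \<open>1 < p ^ e\<close> wild2(1) by (intro mult_mono) auto
    ultimately show ?thesis
      using adjust wild_example_2[OF assms(2,3) wild2(1,5) refl] unfolding B by auto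
  next
    case tame
    have "\<pi> \<noteq> 0"
      using G.not_power_nontrivial(1)[OF \<pi>] tame assms(4) by auto
    then show ?thesis
      using tame_example[OF assms(2,3,4,5)] \<pi> unfolding tame by blast
  qed
qed

end
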